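(* The Burau representation $\eta\colon B_\infty\to \mathrm{GL}(\infty)$ induces a functor from the category $\mathcal K(B_\infty,B_\infty[*])$ to the category $\mathcal K(\mathrm{GL}(\infty),G[*])$: the assignment that is the identity on objects and sends a morphism $B_\infty[s]\,g\,B_\infty[r]$ to $G[s]\,\eta(g)\,G[r]$ is well-defined, preserves identity morphisms and preserves composition.
   Context: $B_\infty$ is the infinite braid group, with generators $\sigma_i$ ($i\ge 1$) and relations $\sigma_i\sigma_j=\sigma_j\sigma_i$ for $|i-j|\ge 2$ and $\sigma_i\sigma_{i+1}\sigma_i=\sigma_{i+1}\sigma_i\sigma_{i+1}$ for $i\geq 1$. For a non-negative integer $\alpha$, $B_\infty[\alpha]=\langle \sigma_j \mid j>\alpha\rangle$. For integers $\beta\ge 0$, $n>0$, put $\tau_i^{(n)}=\sigma_{n+\beta+i}\sigma_{n+\beta+i-1}\cdots\sigma_{\beta+i+1}$ (indices decreasing by one) and $\theta_n[\beta]=\tau_0^{(n)}\tau_1^{(n)}\cdots\tau_{n-1}^{(n)}$. For $\mathfrak p\in B_\infty[\alpha]\backslash B_\infty/B_\infty[\beta]$, $\mathfrak q\in B_\infty[\beta]\backslash B_\infty/B_\infty[\gamma]$ with representatives $p,q$, the product is $\mathfrak p\circ\mathfrak q=B_\infty[\alpha]\,p\,\theta_n[\beta]\,q\,B_\infty[\gamma]$ for $n$ sufficiently large (this is eventually constant in $n$, independent of the representatives, and associative). $\mathrm{GL}(\infty)$ is the direct limit of the groups $\mathrm{GL}(n,\mathbb Z[t,t^{-1}])$ under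 $T\mapsto\begin{pmatrix}T&0\\0&1\end{pmatrix}$; its elements are invertible infinite matrices differing from the identity in finitely many entries. With $v=(1,t,t^2,\dots)$ and $u=(1,1,1,\dots)$ regarded as column vectors, $$G[n]=\left\{\begin{pmatrix}1_n&0\\0&X\end{pmatrix} : X\in \mathrm{GL}(\infty),\ v^{\rm T}X=v^{\rm T},\ Xu=u\right\}.$$ For $j\ge1$, $k\ge0$, $$\Theta_j[k]=\begin{pmatrix}1_k&0&0&0\\0&V_j&t^j1_j&0\\0&1_j&0&0\\0&0&0&1_\infty\end{pmatrix},$$ where $V_j$ is the $j\times j$ matrix each of whose rows is $(1-t)(1,t,\dots,t^{j-1})$. For $\mathfrak p\in G[n]\backslash \mathrm{GL}(\infty)/G[k]$, $\mathfrak q\in G[k]\backslash \mathrm{GL}(\infty)/G[m]$ with representatives $p,q$, the product is $\mathfrak p\star_t\mathfrak q=G[n]\,p\,\Theta_j[k]\,q\,G[m]$ for $j$ sufficiently large (this is eventually constant in $j$, independent of the representatives, and associative). The Burau representation $\eta\colon B_\infty\to\mathrm{GL}(\infty)$ is the homomorphism with $$\eta(\sigma_i)=\begin{pmatrix}1_{i-1}&&\\&\begin{pmatrix}1-t&t\\1&0\end{pmatrix}&\\&&1_\infty\end{pmatrix}.$$ For a group $H$ with a family of subgroups $K[s]$ ($s$ a non-negative integer) carrying a well-defined associative product $K[r]\backslash H/K[s]\times K[s]\backslash H/K[t]\to K[r]\backslash H/K[t]$ for which the class of the identity of $H$ in $K[r]\backslash H/K[r]$ is a two-sided unit, $\mathcal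 K(H,K[*])$ is the category whose objects are the non-negative integers, with $\mathrm{Hom}(r,s)=K[s]\backslash H/K[r]$ and composition given by the product of double cosets. Here the products are $\circ$ for $B_\infty$ and $\star_t$ for $\mathrm{GL}(\infty)$. *)

theory Defs
  imports "HOL-Algebra.Generated_Groups" "HOL-Library.Poly_Mapping"
begin

section \<open>The infinite braid group\<close>

text \<open>
  The letters \<open>(n, True)\<close> and \<open>(n, False)\<close> stand for the generator with
  1-based index \<open>n + 1\<close> and for its inverse.  \<open>braid_eq\<close> is the least
  congruence on words containing free cancellation and the braid relations.
\<close>

type_synonym braid_word = "(nat \<times> bool) list"

inductive braid_eq :: "braid_word \<Rightarrow> braid_word \<Rightarrow> bool" where
  braid_refl: "braid_eq u u"
| braid_sym: "braid_eq u v \<Longrightarrow> braid_eq v u"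
| braid_trans: "braid_eq u v \<Longrightarrow> braid_eq v w \<Longrightarrow> braid_eq u w"
| braid_append: "braid_eq u u' \<Longrightarrow> braid_eq v v' \<Longrightarrow> braid_eq (u @ v) (u' @ v')"
| braid_cancel: "braid_eq [(i, e), (i, \<not> e)] []"
| braid_far: "i + 2 \<le> j \<Longrightarrow> braid_eq [(i, True), (j, True)] [(j, True), (i, True)]"
| braid_near: "braid_eq [(i, True), (i + 1, True), (i, True)]
                  [(i + 1, True), (i, True), (i + 1, True)]"

quotient_type braid = braid_word / braid_eq
  by (intro equivpI reflpI sympI transpI)
    (blast intro: braid_eq.braid_refl braid_eq.braid_sym braid_eq.braid_trans)+

lift_definition braid_mult :: "braid \<Rightarrow> braid \<Rightarrow> braid" is "\<lambda>u v. u @ v"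
  by (rule braid_eq.braid_append)

lift_definition braid_one :: braid is "[]" .

definition B_inf :: "braid monoid" where
  "B_inf = \<lparr>carrier = UNIV, mult = braid_mult, one = braid_one\<rparr>"

text \<open>
  The generators are indexed from 1; \<open>sigma 0\<close> has no meaning (it equals
  \<open>sigma 1\<close>) and is never used below.
\<close>

lift_definition sigma :: "nat \<Rightarrow> braid" is "\<lambda>i. [(i - 1, True)]" .

definition B_sub :: "nat \<Rightarrow> braid set" where
  "B_sub \<alpha> = generate B_inf {sigma j | j. j > \<alpha>}"

definition list_prod :: "('a, 'b) monoid_scheme \<Rightarrow> 'a list \<Rightarrow> 'a" where
  "list_prod G xs = foldr (\<otimes>\<^bsub>G\<^esub>) xs \<one>\<^bsub>G\<^esub>"

text \<open>\<open>tau \<beta> n i = \<sigma>(n+\<beta>+i) \<sigma>(n+\<beta>+i-1) ... \<sigma>(\<beta>+i+1)\<close>\<close>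

definition tau :: "nat \<Rightarrow> nat \<Rightarrow> nat \<Rightarrow> braid" where
  "tau \<beta> n i = list_prod B_inf (map sigma (rev [\<beta> + i + 1 ..< n + \<beta> + i + 1]))"

definition theta :: "nat \<Rightarrow> nat \<Rightarrow> braid" where
  "theta \<beta> n = list_prod B_inf (map (tau \<beta> n) [0 ..< n])"

lemma braid_left_inverse: "braid_eq (rev (map (\<lambda>(i, e). (i, \<not> e)) w) @ w) []"
proof (induction w)
  case Nil
  show ?case by (simp add: braid_eq.braid_refl)
next
  case (Cons l w)
  obtain i e where l: "l = (i, e)" by (cases l)
  let ?r = "rev (map (\<lambda>(i, e). (i, \<not> e)) w)"
  have "braid_eq [(i, \<not> e), (i, e)] []"
    using braid_eq.braid_cancel[of i "\<not> e"] by simp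
  then have "braid_eq (?r @ ([(i, \<not> e), (i, e)] @ w)) (?r @ ([] @ w))"
    by (intro braid_eq.braid_append braid_eq.braid_refl)
  then have "braid_eq (?r @ ([(i, \<not> e), (i, e)] @ w)) []"
    using Cons.IH braid_eq.braid_trans by simp
  then show ?case by (simp add: l)
qed

lemma group_B_inf: "group B_inf"
proof (rule groupI)
  fix x y z assume "x \<in> carrier B_inf" "y \<in> carrier B_inf" "z \<in> carrier B_inf"
  show "x \<otimes>\<^bsub>B_inf\<^esub> y \<otimes>\<^bsub>B_inf\<^esub> z = x \<otimes>\<^bsub>B_inf\<^esub> (y \<otimes>\<^bsub>B_inf\<^esub> z)"
    unfolding B_inf_def by simp (transfer, simp add: braid_eq.braid_refl)
next
  fix x assume "x \<in> carrier B_inf"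
  show "\<one>\<^bsub>B_inf\<^esub> \<otimes>\<^bsub>B_inf\<^esub> x = x"
    unfolding B_inf_def by simp (transfer, simp add: braid_eq.braid_refl)
  have "\<exists>y. braid_mult y x = braid_one"
    by transfer (blast intro: braid_left_inverse)
  then show "\<exists>y\<in>carrier B_inf. y \<otimes>\<^bsub>B_inf\<^esub> x = \<one>\<^bsub>B_inf\<^esub>"
    unfolding B_inf_def by simp
qed (simp_all add: B_inf_def)


section \<open>The group \<open>GL(\<infinity>)\<close> over Laurent polynomials\<close>

text \<open>
  Finitely supported functions from exponents to coefficients, under convolution,
  are the ring of integral Laurent polynomials.
\<close>

type_synonym laurent = "int \<Rightarrow>\<^sub>0 int"

definition tvar :: laurent where "tvar = Poly_Mapping.single 1 1"

text \<open>Rows and columns are numbered from 0.\<close>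

type_synonym inf_mat = "nat \<Rightarrow> nat \<Rightarrow> laurent"

definition id_mat :: inf_mat where
  "id_mat = (\<lambda>i j. if i = j then 1 else 0)"

text \<open>
  \<open>Sum_any\<close> sums the nonzero terms.  There are only finitely many of them whenever a
  finitary matrix is involved.
\<close>

definition mat_mult :: "inf_mat \<Rightarrow> inf_mat \<Rightarrow> inf_mat" where
  "mat_mult A B = (\<lambda>i j. Sum_any (\<lambda>k. A i k * B k j))"

definition finitary :: "inf_mat \<Rightarrow> bool" where
  "finitary A \<longleftrightarrow> finite {(i, j). A i j \<noteq> id_mat i j}"

definition finitary_monoid :: "inf_mat monoid" where
  "finitary_monoid = \<lparr>carrier = {A. finitary A}, mult = mat_mult, one = id_mat\<rparr>"

definition GL_inf :: "inf_mat monoid" where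
  "GL_inf = units_of finitary_monoid"

definition row_times_mat :: "(nat \<Rightarrow> laurent) \<Rightarrow> inf_mat \<Rightarrow> nat \<Rightarrow> laurent" where
  "row_times_mat x A = (\<lambda>j. Sum_any (\<lambda>i. x i * A i j))"

definition mat_times_col :: "inf_mat \<Rightarrow> (nat \<Rightarrow> laurent) \<Rightarrow> nat \<Rightarrow> laurent" where
  "mat_times_col A x = (\<lambda>i. Sum_any (\<lambda>j. A i j * x j))"

definition v_vec :: "nat \<Rightarrow> laurent" where "v_vec = (\<lambda>i. tvar ^ i)"

definition u_vec :: "nat \<Rightarrow> laurent" where "u_vec = (\<lambda>i. 1)"

definition shift_block :: "nat \<Rightarrow> inf_mat \<Rightarrow> inf_mat" where
  "shift_block n X = (\<lambda>i j. if i < n \<or> j < n then id_mat i j else X (i - n) (j - n))"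

definition G_sub :: "nat \<Rightarrow> inf_mat set" where
  "G_sub n = {shift_block n X | X. X \<in> carrier GL_inf
     \<and> row_times_mat v_vec X = v_vec \<and> mat_times_col X u_vec = u_vec}"

definition Theta :: "nat \<Rightarrow> nat \<Rightarrow> inf_mat" where
  "Theta k j = (\<lambda>r c.
     if k \<le> r \<and> r < k + j then
       (if k \<le> c \<and> c < k + j then (1 - tvar) * tvar ^ (c - k)
        else if c = r + j then tvar ^ j else 0)
     else if k + j \<le> r \<and> r < k + 2 * j then (if r = c + j then 1 else 0)
     else id_mat r c)"

definition bounded_mat :: "nat \<Rightarrow> inf_mat \<Rightarrow> bool" where
  "bounded_mat N A \<longleftrightarrow> (\<forall>i j. N \<le> i \<or> N \<le> j \<longrightarrow> A i j = id_mat i j)"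

lemma bounded_mat_mono: "bounded_mat N A \<Longrightarrow> N \<le> M \<Longrightarrow> bounded_mat M A"
  unfolding bounded_mat_def by (meson le_trans)

lemma finitary_iff_bounded: "finitary A \<longleftrightarrow> (\<exists>N. bounded_mat N A)"
proof
  assume "finitary A"
  then have fin: "finite {(i, j). A i j \<noteq> id_mat i j}" by (simp add: finitary_def)
  let ?S = "fst ` {(i, j). A i j \<noteq> id_mat i j} \<union> snd ` {(i, j). A i j \<noteq> id_mat i j}"
  have "finite ?S" using fin by blast
  then obtain N where N: "\<forall>x\<in>?S. x < N"
    using finite_nat_set_iff_bounded by blast
  have "bounded_mat N A"
    unfolding bounded_mat_def
  proof (intro allI impI)
    fix i j assume *: "N \<le> i \<or> N \<le> j"
    show "A i j = id_mat i j"
    proof (rule ccontr)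
      assume "A i j \<noteq> id_mat i j"
      then have "i \<in> ?S" "j \<in> ?S" by force+
      with N * show False by (meson not_le)
    qed
  qed
  then show "\<exists>N. bounded_mat N A" ..
next
  assume "\<exists>N. bounded_mat N A"
  then obtain N where N: "bounded_mat N A" ..
  have "{(i, j). A i j \<noteq> id_mat i j} \<subseteq> {..<N} \<times> {..<N}"
    using N unfolding bounded_mat_def by (auto simp: not_le[symmetric])
  then show "finitary A" unfolding finitary_def by (rule finite_subset) simp
qed

lemma mat_mult_eq_sum:
  assumes "bounded_mat N A" "N \<le> M" "i < M"
  shows "mat_mult A B i j = (\<Sum>k<M. A i k * B k j)"
  unfolding mat_mult_def
proof (rule Sum_any.expand_superset)
  show "{k. A i k * B k j \<noteq> 0} \<subseteq> {..<M}"
  proof clarify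
    fix k assume nz: "A i k * B k j \<noteq> 0"
    show "k < M"
    proof (rule ccontr)
      assume "\<not> k < M"
      then have "A i k = id_mat i k" "i \<noteq> k"
        using assms by (auto simp: bounded_mat_def)
      with nz show False by (simp add: id_mat_def)
    qed
  qed
qed simp

lemma bounded_mat_mult:
  assumes A: "bounded_mat N A" and B: "bounded_mat N B"
  shows "bounded_mat N (mat_mult A B)"
  unfolding bounded_mat_def
proof (intro allI impI)
  fix i j assume *: "N \<le> i \<or> N \<le> j"
  define M where "M = Suc (N + i + j)"
  have "mat_mult A B i j = (\<Sum>k<M. A i k * B k j)"
    using A by (rule mat_mult_eq_sum) (auto simp: M_def)
  also have "\<dots> = id_mat i j"
  proof (cases "N \<le> i")
    case True
    then have "(\<Sum>k<M. A i k * B k j) = (\<Sum>k<M. if i = k then B k j else 0)"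
      using A by (intro sum.cong) (auto simp: bounded_mat_def id_mat_def)
    also have "\<dots> = B i j" by (simp add: M_def)
    finally show ?thesis using B True by (simp add: bounded_mat_def)
  next
    case False
    with * have "N \<le> j" by simp
    then have "(\<Sum>k<M. A i k * B k j) = (\<Sum>k<M. if k = j then A i k else 0)"
      using B by (intro sum.cong) (auto simp: bounded_mat_def id_mat_def)
    also have "\<dots> = A i j" by (simp add: M_def)
    finally show ?thesis using A \<open>N \<le> j\<close> by (simp add: bounded_mat_def)
  qed
  finally show "mat_mult A B i j = id_mat i j" .
qed

lemma bounded_id_mat: "bounded_mat N id_mat"
  by (simp add: bounded_mat_def)

lemma common_bound:
  assumes "finitary A" "finitary B"
  obtains N where "bounded_mat N A" "bounded_mat N B"
  using assms unfolding finitary_iff_bounded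
  by (meson bounded_mat_mono max.cobounded1 max.cobounded2)

lemma finitary_mat_mult: "finitary A \<Longrightarrow> finitary B \<Longrightarrow> finitary (mat_mult A B)"
  by (metis common_bound bounded_mat_mult finitary_iff_bounded)

lemma mat_mult_assoc:
  assumes "finitary A" "finitary B"
  shows "mat_mult (mat_mult A B) C = mat_mult A (mat_mult B C)"
proof (intro ext)
  fix i j
  obtain N where A: "bounded_mat N A" and B: "bounded_mat N B"
    using assms by (rule common_bound)
  define M where "M = Suc (N + i)"
  have M: "N \<le> M" "i < M" by (auto simp: M_def)
  have "mat_mult (mat_mult A B) C i j = (\<Sum>k<M. (\<Sum>l<M. A i l * B l k) * C k j)"
    using mat_mult_eq_sum[OF bounded_mat_mult[OF A B] M] mat_mult_eq_sum[OF A M] by simp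
  also have "\<dots> = (\<Sum>k<M. \<Sum>l<M. A i l * (B l k * C k j))"
    by (simp add: sum_distrib_right mult.assoc)
  also have "\<dots> = (\<Sum>l<M. \<Sum>k<M. A i l * (B l k * C k j))" by (rule sum.swap)
  also have "\<dots> = (\<Sum>l<M. A i l * (\<Sum>k<M. B l k * C k j))"
    by (simp add: sum_distrib_left)
  also have "\<dots> = (\<Sum>l<M. A i l * mat_mult B C l j)"
  proof (intro sum.cong refl)
    fix l assume "l \<in> {..<M}"
    then have "l < M" by simp
    from mat_mult_eq_sum[OF B M(1) this, of C j]
    show "A i l * (\<Sum>k<M. B l k * C k j) = A i l * mat_mult B C l j"
      by (simp only:)
  qed
  also have "\<dots> = mat_mult A (mat_mult B C) i j"
    using mat_mult_eq_sum[OF A M] by simp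
  finally show "mat_mult (mat_mult A B) C i j = mat_mult A (mat_mult B C) i j" .
qed

lemma mat_mult_id_left: "mat_mult id_mat A = A"
proof (intro ext)
  fix i j
  have "mat_mult id_mat A i j = (\<Sum>k<Suc i. id_mat i k * A k j)"
    using bounded_id_mat[of 0] by (rule mat_mult_eq_sum) auto
  also have "\<dots> = (\<Sum>k<Suc i. if k = i then A k j else 0)"
    by (intro sum.cong) (auto simp: id_mat_def)
  finally show "mat_mult id_mat A i j = A i j" by simp
qed

lemma mat_mult_id_right: "mat_mult A id_mat = A"
proof (intro ext)
  fix i j
  have "(\<lambda>k. A i k * id_mat k j) = (\<lambda>k. if k = j then A i k else 0)"
    by (auto simp: id_mat_def)
  then have "mat_mult A id_mat i j = Sum_any (\<lambda>k. if k = j then A i k else 0)"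
    by (simp only: mat_mult_def)
  then show "mat_mult A id_mat i j = A i j" by simp
qed

lemma monoid_finitary: "monoid finitary_monoid"
  by (rule monoidI)
    (auto simp: finitary_monoid_def finitary_mat_mult mat_mult_assoc
      mat_mult_id_left mat_mult_id_right finitary_iff_bounded[of id_mat] bounded_id_mat)

lemma group_GL_inf: "group GL_inf"
  unfolding GL_inf_def using monoid_finitary by (rule monoid.units_group)

lemma GL_inf_mult [simp]: "A \<otimes>\<^bsub>GL_inf\<^esub> B = mat_mult A B"
  by (simp add: GL_inf_def units_of_def finitary_monoid_def)

lemma GL_inf_one [simp]: "\<one>\<^bsub>GL_inf\<^esub> = id_mat"
  by (simp add: GL_inf_def units_of_def finitary_monoid_def)

lemma GL_inf_carrier:
  "A \<in> carrier GL_inf \<longleftrightarrow>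
    finitary A \<and> (\<exists>B. finitary B \<and> mat_mult A B = id_mat \<and> mat_mult B A = id_mat)"
  by (auto simp: GL_inf_def units_of_def Units_def finitary_monoid_def)


section \<open>The Burau representation\<close>

text \<open>
  \<open>burau_gen n\<close> is the image of the generator with 1-based index \<open>n + 1\<close>, so that its
  2 by 2 block occupies the rows and columns \<open>n\<close> and \<open>n + 1\<close>, counted from 0.
\<close>

definition burau_gen :: "nat \<Rightarrow> inf_mat" where
  "burau_gen n = (\<lambda>i j.
     if i = n then (if j = n then 1 - tvar else if j = n + 1 then tvar else 0)
     else if i = n + 1 then (if j = n then 1 else 0)
     else id_mat i j)"

fun burau_word :: "braid_word \<Rightarrow> inf_mat" where
  "burau_word [] = \<one>\<^bsub>GL_inf\<^esub>"
| "burau_word ((n, e) # w) =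
     (if e then burau_gen n else inv\<^bsub>GL_inf\<^esub> (burau_gen n)) \<otimes>\<^bsub>GL_inf\<^esub> burau_word w"

definition tvar_inv :: laurent where "tvar_inv = Poly_Mapping.single (-1) 1"

lemma tvar_tvar_inv: "tvar * tvar_inv = 1" "tvar_inv * tvar = 1"
  by (simp_all add: tvar_def tvar_inv_def mult_single)

definition burau_gen_inv :: "nat \<Rightarrow> inf_mat" where
  "burau_gen_inv n = (\<lambda>i j.
     if i = n then (if j = n + 1 then 1 else 0)
     else if i = n + 1 then
       (if j = n then tvar_inv else if j = n + 1 then 1 - tvar_inv else 0)
     else id_mat i j)"

lemma bounded_burau_gen: "bounded_mat (n + 2) (burau_gen n)"
  "bounded_mat (n + 2) (burau_gen_inv n)"
  by (auto simp: bounded_mat_def burau_gen_def burau_gen_inv_def id_mat_def)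

lemma two_term_sum:
  fixes a b :: laurent and n M :: nat
  assumes "n + 1 < M"
  shows "(\<Sum>k<M. (if k = n then a else if k = n + 1 then b else 0) * f k)
    = a * f n + b * f (n + 1)"
proof -
  have "(\<Sum>k<M. (if k = n then a else if k = n + 1 then b else 0) * f k)
    = (\<Sum>k<M. (if k = n then a * f k else 0) + (if k = n + 1 then b * f k else 0))"
    by (intro sum.cong) auto
  also have "\<dots> = a * f n + b * f (n + 1)"
    using assms by (simp add: sum.distrib)
  finally show ?thesis .
qed

lemma one_term_sum:
  fixes f :: "nat \<Rightarrow> laurent"
  assumes "i < M"
  shows "(\<Sum>k<M. id_mat i k * f k) = f i"
proof -
  have "(\<Sum>k<M. id_mat i k * f k) = (\<Sum>k<M. if k = i then f k else 0)"
    by (intro sum.cong) (auto simp: id_mat_def)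
  then show ?thesis using assms by simp
qed

lemma burau_gen_mult:
  "mat_mult (burau_gen n) B = (\<lambda>i j.
     if i = n then (1 - tvar) * B n j + tvar * B (n + 1) j
     else if i = n + 1 then B n j else B i j)"
proof (intro ext)
  fix i j
  define M where "M = n + i + 3"
  have M: "n + 2 \<le> M" "i < M" "n + 1 < M" by (auto simp: M_def)
  have *: "mat_mult (burau_gen n) B i j = (\<Sum>k<M. burau_gen n i k * B k j)"
    by (rule mat_mult_eq_sum[OF bounded_burau_gen(1) M(1,2)])
  consider "i = n" | "i = n + 1" | "i \<noteq> n" "i \<noteq> n + 1" by blast
  then show "mat_mult (burau_gen n) B i j = (if i = n then (1 - tvar) * B n j + tvar * B (n + 1) j
     else if i = n + 1 then B n j else B i j)"
  proof cases
    case 1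
    then show ?thesis
      using two_term_sum[OF M(3), of "1 - tvar" tvar "\<lambda>k. B k j"] *
      by (simp add: burau_gen_def)
  next
    case 2
    have "(if k = n then 1 else 0 :: laurent) = (if k = n then 1 else if k = n + 1 then 0 else 0)"
      for k by simp
    then show ?thesis
      using two_term_sum[OF M(3), of 1 0 "\<lambda>k. B k j"] * 2
      by (simp add: burau_gen_def)
  next
    case 3
    then show ?thesis
      using one_term_sum[OF M(2), of "\<lambda>k. B k j"] * by (simp add: burau_gen_def)
  qed
qed

lemma burau_gen_inv_mult:
  "mat_mult (burau_gen_inv n) B = (\<lambda>i j.
     if i = n then B (n + 1) j
     else if i = n + 1 then tvar_inv * B n j + (1 - tvar_inv) * B (n + 1) j else B i j)"
proof (intro ext)
  fix i j
  define M where "M = n + i + 3"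
  have M: "n + 2 \<le> M" "i < M" "n + 1 < M" by (auto simp: M_def)
  have *: "mat_mult (burau_gen_inv n) B i j = (\<Sum>k<M. burau_gen_inv n i k * B k j)"
    by (rule mat_mult_eq_sum[OF bounded_burau_gen(2) M(1,2)])
  consider "i = n" | "i = n + 1" | "i \<noteq> n" "i \<noteq> n + 1" by blast
  then show "mat_mult (burau_gen_inv n) B i j = (if i = n then B (n + 1) j
     else if i = n + 1 then tvar_inv * B n j + (1 - tvar_inv) * B (n + 1) j else B i j)"
  proof cases
    case 1
    have "(if k = n + 1 then 1 else 0 :: laurent) = (if k = n then 0 else if k = n + 1 then 1 else 0)"
      for k by simp
    then show ?thesis
      using two_term_sum[OF M(3), of 0 1 "\<lambda>k. B k j"] * 1
      by (simp add: burau_gen_inv_def)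
  next
    case 2
    then show ?thesis
      using two_term_sum[OF M(3), of tvar_inv "1 - tvar_inv" "\<lambda>k. B k j"] *
      by (simp add: burau_gen_inv_def)
  next
    case 3
    then show ?thesis
      using one_term_sum[OF M(2), of "\<lambda>k. B k j"] * by (simp add: burau_gen_inv_def)
  qed
qed

lemma burau_gen_inverse:
  "mat_mult (burau_gen n) (burau_gen_inv n) = id_mat"
  "mat_mult (burau_gen_inv n) (burau_gen n) = id_mat"
  unfolding burau_gen_mult burau_gen_inv_mult
  by (intro ext; simp add: burau_gen_def burau_gen_inv_def id_mat_def tvar_tvar_inv algebra_simps)+

lemma burau_gen_closed: "burau_gen n \<in> carrier GL_inf"
  unfolding GL_inf_carrier
  using burau_gen_inverse bounded_burau_gen finitary_iff_bounded by blast

lemma burau_gen_far: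
  assumes "i + 2 \<le> j"
  shows "mat_mult (burau_gen i) (burau_gen j) = mat_mult (burau_gen j) (burau_gen i)"
  unfolding burau_gen_mult using assms
  by (intro ext) (auto simp: burau_gen_def id_mat_def)

lemma burau_gen_near:
  "mat_mult (burau_gen i) (mat_mult (burau_gen (i + 1)) (burau_gen i)) =
   mat_mult (burau_gen (i + 1)) (mat_mult (burau_gen i) (burau_gen (i + 1)))"
  unfolding burau_gen_mult
  by (intro ext) (auto simp: burau_gen_def id_mat_def algebra_simps)

lemma burau_letter_closed:
  "(if e then burau_gen n else inv\<^bsub>GL_inf\<^esub> (burau_gen n)) \<in> carrier GL_inf"
  using group.inv_closed[OF group_GL_inf burau_gen_closed] burau_gen_closed by simp

lemma burau_word_closed: "burau_word w \<in> carrier GL_inf"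
proof (induction w rule: burau_word.induct)
  case 1
  show ?case by (simp only: burau_word.simps monoid.one_closed[OF group.is_monoid[OF group_GL_inf]])
next
  case (2 n e w)
  then show ?case
    by (simp only: burau_word.simps
        monoid.m_closed[OF group.is_monoid[OF group_GL_inf] burau_letter_closed])
qed

lemma burau_word_append:
  "burau_word (u @ v) = burau_word u \<otimes>\<^bsub>GL_inf\<^esub> burau_word v"
proof (induction u rule: burau_word.induct)
  case 1
  show ?case by (simp add: mat_mult_id_left)
next
  case (2 n e w)
  then show ?case
    using monoid.m_assoc[OF group.is_monoid[OF group_GL_inf] burau_letter_closed
        burau_word_closed burau_word_closed]
    by (simp only: append_Cons burau_word.simps)
qed

lemma burau_word_cong: "braid_eq u v \<Longrightarrow> burau_word u = burau_word v"
proof (induction rule: braid_eq.induct)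
  case (braid_append u u' v v')
  then show ?case by (simp only: burau_word_append)
next
  case (braid_cancel i e)
  show ?case
    using group.r_inv[OF group_GL_inf burau_gen_closed[of i]]
      group.l_inv[OF group_GL_inf burau_gen_closed[of i]]
    by (cases e) (simp_all add: mat_mult_id_right)
next
  case (braid_far i j)
  then show ?case using burau_gen_far by (simp add: mat_mult_id_right)
next
  case (braid_near i)
  show ?case using burau_gen_near[of i] by (simp add: mat_mult_id_right)
qed simp_all

lift_definition burau :: "braid \<Rightarrow> inf_mat" is burau_word
  by (rule burau_word_cong)

lemma burau_hom: "burau \<in> hom B_inf GL_inf"
proof (rule homI)
  fix x
  show "burau x \<in> carrier GL_inf" by transfer (rule burau_word_closed)
next
  fix x y
  have "burau (braid_mult x y) = burau x \<otimes>\<^bsub>GL_inf\<^esub> burau y"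
    by transfer (rule burau_word_append)
  then show "burau (x \<otimes>\<^bsub>B_inf\<^esub> y) = burau x \<otimes>\<^bsub>GL_inf\<^esub> burau y"
    by (simp add: B_inf_def)
qed

lemma burau_sigma: "burau (sigma i) = burau_gen (i - 1)"
  by transfer (simp add: mat_mult_id_right)


section \<open>Categories, functors and categories of double cosets\<close>

text \<open>
  Hom-sets need not be disjoint, so composition carries its objects:
  \<open>Comp C r s t g f\<close> is the composite of \<open>f \<in> Hom C r s\<close> followed by \<open>g \<in> Hom C s t\<close>.
\<close>

record ('o, 'm) cat =
  Ob :: "'o set"
  Hom :: "'o \<Rightarrow> 'o \<Rightarrow> 'm set"
  Id :: "'o \<Rightarrow> 'm"
  Comp :: "'o \<Rightarrow> 'o \<Rightarrow> 'o \<Rightarrow> 'm \<Rightarrow> 'm \<Rightarrow> 'm"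

definition is_category :: "('o, 'm) cat \<Rightarrow> bool" where
  "is_category C \<longleftrightarrow>
     (\<forall>r\<in>Ob C. Id C r \<in> Hom C r r) \<and>
     (\<forall>r\<in>Ob C. \<forall>s\<in>Ob C. \<forall>t\<in>Ob C. \<forall>f\<in>Hom C r s. \<forall>g\<in>Hom C s t.
        Comp C r s t g f \<in> Hom C r t) \<and>
     (\<forall>r\<in>Ob C. \<forall>s\<in>Ob C. \<forall>f\<in>Hom C r s.
        Comp C r s s (Id C s) f = f \<and> Comp C r r s f (Id C r) = f) \<and>
     (\<forall>q\<in>Ob C. \<forall>r\<in>Ob C. \<forall>s\<in>Ob C. \<forall>t\<in>Ob C.
        \<forall>f\<in>Hom C q r. \<forall>g\<in>Hom C r s. \<forall>h\<in>Hom C s t.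
        Comp C q s t h (Comp C q r s g f) = Comp C q r t (Comp C r s t h g) f)"

definition is_functor ::
  "('o, 'm) cat \<Rightarrow> ('p, 'n) cat \<Rightarrow> ('o \<Rightarrow> 'p) \<Rightarrow> ('o \<Rightarrow> 'o \<Rightarrow> 'm \<Rightarrow> 'n) \<Rightarrow> bool" where
  "is_functor C D Fo Fm \<longleftrightarrow>
     is_category C \<and> is_category D \<and>
     (\<forall>r\<in>Ob C. Fo r \<in> Ob D) \<and>
     (\<forall>r\<in>Ob C. \<forall>s\<in>Ob C. \<forall>f\<in>Hom C r s. Fm r s f \<in> Hom D (Fo r) (Fo s)) \<and>
     (\<forall>r\<in>Ob C. Fm r r (Id C r) = Id D (Fo r)) \<and>
     (\<forall>r\<in>Ob C. \<forall>s\<in>Ob C. \<forall>t\<in>Ob C. \<forall>f\<in>Hom C r s. \<forall>g\<in>Hom C s t.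
        Fm r t (Comp C r s t g f) = Comp D (Fo r) (Fo s) (Fo t) (Fm s t g) (Fm r s f))"

definition double_coset ::
  "('g, 'x) monoid_scheme \<Rightarrow> 'g set \<Rightarrow> 'g \<Rightarrow> 'g set \<Rightarrow> 'g set" where
  "double_coset H K x L = (K #>\<^bsub>H\<^esub> x) <#>\<^bsub>H\<^esub> L"

definition double_cosets ::
  "('g, 'x) monoid_scheme \<Rightarrow> 'g set \<Rightarrow> 'g set \<Rightarrow> 'g set set" where
  "double_cosets H K L = {double_coset H K x L | x. x \<in> carrier H}"

text \<open>
  For \<open>P\<close> in \<open>K a \ H / K b\<close> and \<open>Q\<close> in \<open>K b \ H / K c\<close>, the product is the double coset
  that \<open>K a p (\<theta> b n) q K c\<close> equals for all large \<open>n\<close>, whatever the representatives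
  \<open>p\<close> and \<open>q\<close> (how large \<open>n\<close> has to be may depend on them).
\<close>

definition double_coset_prod ::
  "('g, 'x) monoid_scheme \<Rightarrow> (nat \<Rightarrow> 'g set) \<Rightarrow> (nat \<Rightarrow> nat \<Rightarrow> 'g) \<Rightarrow>
   nat \<Rightarrow> nat \<Rightarrow> nat \<Rightarrow> 'g set \<Rightarrow> 'g set \<Rightarrow> 'g set" where
  "double_coset_prod H K \<theta> a b c P Q =
     (THE R. \<forall>p\<in>P. \<forall>q\<in>Q. \<exists>N. \<forall>n\<ge>N.
        double_coset H (K a) (p \<otimes>\<^bsub>H\<^esub> \<theta> b n \<otimes>\<^bsub>H\<^esub> q) (K c) = R)"

definition double_coset_cat ::
  "('g, 'x) monoid_scheme \<Rightarrow> (nat \<Rightarrow> 'g set) \<Rightarrow> (nat \<Rightarrow> nat \<Rightarrow> 'g) \<Rightarrow> (nat, 'g set) cat" where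
  "double_coset_cat H K \<theta> =
     \<lparr>Ob = UNIV,
      Hom = (\<lambda>r s. double_cosets H (K s) (K r)),
      Id = (\<lambda>r. double_coset H (K r) \<one>\<^bsub>H\<^esub> (K r)),
      Comp = (\<lambda>r s t g f. double_coset_prod H K \<theta> t s r g f)\<rparr>"

definition braid_cat :: "(nat, braid set) cat" where
  "braid_cat = double_coset_cat B_inf B_sub theta"

definition GL_cat :: "(nat, inf_mat set) cat" where
  "GL_cat = double_coset_cat GL_inf G_sub Theta"

end

theory Submission
  imports Defs
begin

text \<open>
  Let \<open>X(b;m,n)\<close> be the positive braid in which the \<open>m\<close> strands after strand \<open>b\<close> cross the next
  \<open>n\<close> strands, so that \<open>\<theta>\<^sub>n[b] = X(b;n,n)\<close>. These braids are additive in both \<open>m\<close> and \<open>n\<close>, lie in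
  \<open>B_sub b\<close>, commute with \<open>B_sub (b + m + n)\<close>, and moving a fixed element of \<open>B_sub b\<close> through
  \<open>\<theta>\<^sub>n[b]\<close> on either side shifts it by \<open>n\<close>. These properties alone force the double coset
  product to be well defined, associative and unital. The Burau image of \<open>X(b;n,n)\<close> is exactly
  \<open>Theta b n\<close>, and the images of the braids \<open>X(b;m,n)\<close> have the same properties in \<open>GL_inf\<close>
  with respect to \<open>G_sub\<close>; the two fixed vectors of \<open>G_sub\<close> are what is needed to move an
  element through \<open>Theta\<close>. The functor axioms then follow since \<open>burau\<close> maps one set of
  data to the other.
\<close>

section \<open>Double coset categories from block swaps\<close>

text \<open>Rectangular swaps appear beside the square ones because splitting a square swap produces
  them. \<open>commute_ex\<close> expresses finite support. The passing axioms are asked only for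
  large \<open>n\<close>: in both applications the support of \<open>k\<close> must first fit into
  the \<open>n\<close> strands being crossed.\<close>

locale block_swap_system = group H for H (structure) +
  fixes K :: "nat \<Rightarrow> 'a set" and X :: "nat \<Rightarrow> nat \<Rightarrow> nat \<Rightarrow> 'a"
  assumes subgroup_K: "subgroup (K n) H"
    and K_antimono: "m \<le> n \<Longrightarrow> K n \<subseteq> K m"
    and commute_ex: "p \<in> carrier H \<Longrightarrow> \<exists>N. \<forall>x\<in>K N. x \<otimes> p = p \<otimes> x"
    and swap_in: "X b m n \<in> K b"
    and swap_commute: "x \<in> K (b + m + n) \<Longrightarrow> x \<otimes> X b m n = X b m n \<otimes> x"
    and swap_add_left: "X b (m1 + m2) n = X (b + m1) m2 n \<otimes> X b m1 n"
    and swap_add_right: "X b m (n1 + n2) = X b m n1 \<otimes> X (b + n1) m n2"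
    and pass_right: "k \<in> K b \<Longrightarrow>
      \<forall>\<^sub>F n in sequentially. \<exists>k'\<in>K (b + n). k \<otimes> X b n n = X b n n \<otimes> k'"
    and pass_left: "k \<in> K b \<Longrightarrow>
      \<forall>\<^sub>F n in sequentially. \<exists>k'\<in>K (b + n). X b n n \<otimes> k = k' \<otimes> X b n n"
begin

abbreviation DC :: "nat \<Rightarrow> 'a \<Rightarrow> nat \<Rightarrow> 'a set" where
  "DC a x c \<equiv> double_coset H (K a) x (K c)"

abbreviation DC_prod :: "nat \<Rightarrow> nat \<Rightarrow> nat \<Rightarrow> 'a set \<Rightarrow> 'a set \<Rightarrow> 'a set" where
  "DC_prod \<equiv> double_coset_prod H K (\<lambda>b n. X b n n)"

section \<open>Calculus of double cosets\<close>

lemma K_carrier [simp]: "x \<in> K n \<Longrightarrow> x \<in> carrier H"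
  using subgroup.mem_carrier[OF subgroup_K] .

lemma swap_carrier [simp]: "X b m n \<in> carrier H"
  by (rule K_carrier[OF swap_in])

lemma K_mono: "x \<in> K n \<Longrightarrow> m \<le> n \<Longrightarrow> x \<in> K m"
  using K_antimono by blast

lemma DC_iff: "x \<in> DC a p b \<longleftrightarrow> (\<exists>k\<in>K a. \<exists>l\<in>K b. x = k \<otimes> p \<otimes> l)"
  by (auto simp: double_coset_def r_coset_def set_mult_def)

lemma DC_self: "p \<in> carrier H \<Longrightarrow> p \<in> DC a p b"
  unfolding DC_iff
  by (metis subgroup.one_closed[OF subgroup_K] l_one r_one)

lemma DC_absorb:
  assumes "k \<in> K a" "l \<in> K b" "x \<in> carrier H"
  shows "DC a (k \<otimes> x \<otimes> l) b = DC a x b"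
proof -
  have sub: "DC a (k \<otimes> y \<otimes> l) b \<subseteq> DC a y b" if "k \<in> K a" "l \<in> K b" "y \<in> carrier H" for k l y
  proof
    fix z assume "z \<in> DC a (k \<otimes> y \<otimes> l) b"
    then obtain k' l' where "k' \<in> K a" "l' \<in> K b" "z = k' \<otimes> (k \<otimes> y \<otimes> l) \<otimes> l'"
      unfolding DC_iff by blast
    then have "z = (k' \<otimes> k) \<otimes> y \<otimes> (l \<otimes> l')" "k' \<otimes> k \<in> K a" "l \<otimes> l' \<in> K b"
      using that by (auto simp: m_assoc subgroup.m_closed[OF subgroup_K])
    then show "z \<in> DC a y b" unfolding DC_iff by blast
  qed
  \<comment> \<open>The reverse inclusion is \<open>sub\<close> once more, the inverses of
    \<open>k\<close> and \<open>l\<close> undoing the change of representative.\<close>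
  have "inv k \<otimes> (k \<otimes> x \<otimes> l) \<otimes> inv l = (inv k \<otimes> k) \<otimes> x \<otimes> (l \<otimes> inv l)"
    using assms by (simp only: m_assoc K_carrier inv_closed m_closed)
  then have "x = inv k \<otimes> (k \<otimes> x \<otimes> l) \<otimes> inv l"
    using assms by simp
  then have "DC a x b \<subseteq> DC a (k \<otimes> x \<otimes> l) b"
    using sub[of "inv k" "inv l" "k \<otimes> x \<otimes> l"] assms
    by (simp add: subgroup.m_inv_closed[OF subgroup_K])
  then show ?thesis using sub[OF assms] by blast
qed

lemma DC_absorb_left: "k \<in> K a \<Longrightarrow> x \<in> carrier H \<Longrightarrow> DC a (k \<otimes> x) b = DC a x b"
  using DC_absorb[of k a "\<one>" b x] by (simp add: subgroup.one_closed[OF subgroup_K])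

lemma DC_absorb_right: "l \<in> K b \<Longrightarrow> x \<in> carrier H \<Longrightarrow> DC a (x \<otimes> l) b = DC a x b"
  using DC_absorb[of "\<one>" a l b x] by (simp add: subgroup.one_closed[OF subgroup_K])

section \<open>Stabilisation of the product and independence of representatives\<close>

lemma commute_eventually:
  assumes "p \<in> carrier H"
  shows "\<forall>\<^sub>F n in sequentially. \<forall>x\<in>K n. p \<otimes> x = x \<otimes> p"
proof -
  obtain N where "\<forall>x\<in>K N. x \<otimes> p = p \<otimes> x" using commute_ex assms by blast
  then show ?thesis unfolding eventually_sequentially
    by (intro exI[of _ N]) (metis K_mono)
qed

lemma commute_eventually_shift:
  assumes "p \<in> carrier H"
  shows "\<forall>\<^sub>F n in sequentially. \<forall>x\<in>K (b + n). p \<otimes> x = x \<otimes> p"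
proof -
  obtain N where "\<forall>n\<ge>N. \<forall>x\<in>K n. p \<otimes> x = x \<otimes> p"
    using commute_eventually[OF assms] unfolding eventually_sequentially by blast
  then show ?thesis unfolding eventually_sequentially
    by (intro exI[of _ N]) (meson trans_le_add2)
qed

lemma left_commute:
  "\<lbrakk>x \<otimes> y = y \<otimes> x; x \<in> carrier H; y \<in> carrier H; z \<in> carrier H\<rbrakk> \<Longrightarrow>
    x \<otimes> (y \<otimes> z) = y \<otimes> (x \<otimes> z)"
  by (metis m_assoc)

text \<open>Additivity in both indices shows that one more strand multiplies the swap by
  \<open>Y\<close> on the left and by \<open>Z\<close> on the right. Both lie in
  \<open>K (b + n)\<close>, so \<open>Y\<close> moves past \<open>p\<close> and \<open>Z\<close>
  past \<open>q\<close> to the ends, where \<open>K a\<close> and \<open>K c\<close> absorb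
  them.\<close>

lemma DC_swap_Suc:
  assumes p: "p \<in> carrier H" "\<forall>x\<in>K (b + n). p \<otimes> x = x \<otimes> p"
    and q: "q \<in> carrier H" "\<forall>x\<in>K (b + n). q \<otimes> x = x \<otimes> q"
    and le: "a \<le> b + n" "c \<le> b + n"
  shows "DC a (p \<otimes> X b (Suc n) (Suc n) \<otimes> q) c = DC a (p \<otimes> X b n n \<otimes> q) c"
proof -
  define Y where "Y = X (b + n) 1 (n + 1)"
  define Z where "Z = X (b + n) n 1"
  have YZ: "Y \<in> K (b + n)" "Z \<in> K (b + n)" by (simp_all add: Y_def Z_def swap_in)
  have "X b (Suc n) (Suc n) = Y \<otimes> (X b n n \<otimes> Z)"
    using swap_add_left[of b n 1 "n + 1"] swap_add_right[of b n n 1]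
    by (simp add: Y_def Z_def)
  moreover have "p \<otimes> (Y \<otimes> (X b n n \<otimes> Z)) \<otimes> q = Y \<otimes> (p \<otimes> X b n n \<otimes> q) \<otimes> Z"
    using YZ p q by (simp add: m_assoc left_commute[of p Y])
  ultimately show ?thesis
    using DC_absorb[of Y a Z c] YZ le p q K_mono by simp
qed

lemma DC_swap_stable:
  assumes "p \<in> carrier H" "q \<in> carrier H"
  obtains N where "\<And>n. N \<le> n \<Longrightarrow> DC a (p \<otimes> X b n n \<otimes> q) c = DC a (p \<otimes> X b N N \<otimes> q) c"
proof -
  have "\<forall>\<^sub>F n in sequentially. (\<forall>x\<in>K (b + n). p \<otimes> x = x \<otimes> p) \<and> (\<forall>x\<in>K (b + n). q \<otimes> x = x \<otimes> q)
      \<and> max a c \<le> n"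
    by (intro eventually_conj commute_eventually_shift assms eventually_ge_at_top)
  then obtain N where N: "\<And>n. n \<ge> N \<Longrightarrow> (\<forall>x\<in>K (b + n). p \<otimes> x = x \<otimes> p)
      \<and> (\<forall>x\<in>K (b + n). q \<otimes> x = x \<otimes> q) \<and> max a c \<le> n"
    unfolding eventually_sequentially by blast
  have "DC a (p \<otimes> X b n n \<otimes> q) c = DC a (p \<otimes> X b N N \<otimes> q) c" if "N \<le> n" for n
    using that
  proof (induction n rule: dec_induct)
    case (step n)
    have "a \<le> b + n" "c \<le> b + n" using N[OF step.hyps(1)] by auto
    then show ?case
      using step.IH DC_swap_Suc[of p b n q a c] N[OF step.hyps(1)] assms by blast
  qed simp
  then show thesis using that by blast
qed

text \<open>The outer factors of \<open>p'\<close> and \<open>q'\<close> are absorbed at once. The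
  inner ones, in \<open>K b\<close>, are passed through the swap; this pushes them into
  \<open>K (b + n)\<close>, so that they commute with what remains and reach the opposite
  end.\<close>

lemma DC_swap_representatives:
  assumes p: "p \<in> carrier H" and q: "q \<in> carrier H"
    and p': "p' \<in> DC a p b" and q': "q' \<in> DC b q c"
  shows "\<forall>\<^sub>F n in sequentially. DC a (p' \<otimes> X b n n \<otimes> q') c = DC a (p \<otimes> X b n n \<otimes> q) c"
proof -
  obtain k l where kl: "k \<in> K a" "l \<in> K b" "p' = k \<otimes> p \<otimes> l"
    using p' unfolding DC_iff by blast
  obtain l' k' where kl': "l' \<in> K b" "k' \<in> K c" "q' = l' \<otimes> q \<otimes> k'"
    using q' unfolding DC_iff by blast
  have "\<forall>\<^sub>F n in sequentially. \<forall>x\<in>K (b + n). p \<otimes> x = x \<otimes> p"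
    "\<forall>\<^sub>F n in sequentially. \<forall>x\<in>K (b + n). (l' \<otimes> q) \<otimes> x = x \<otimes> (l' \<otimes> q)"
    "\<forall>\<^sub>F n in sequentially. max a c \<le> n"
    using p q kl' by (simp_all only: commute_eventually_shift eventually_ge_at_top m_closed K_carrier)
  then show ?thesis using pass_right[OF kl(2)] pass_left[OF kl'(1)]
  proof eventually_elim
    case (elim n)
    \<comment> \<open>\<open>l\<close> is moved first and lands in front of
      \<open>l' \<otimes> q\<close>; hence commutation was arranged for this product and not for
      \<open>q\<close> alone.\<close>
    obtain l1 where l1: "l1 \<in> K (b + n)" "l \<otimes> X b n n = X b n n \<otimes> l1" using elim by blast
    obtain l2 where l2: "l2 \<in> K (b + n)" "X b n n \<otimes> l' = l2 \<otimes> X b n n" using elim by blast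
    have in_K: "l1 \<in> K c" "l2 \<in> K a" using elim l1 l2 K_mono by (meson max.boundedE trans_le_add2)+
    note [simp] = p q kl(1) kl'(2) in_K K_carrier[OF kl(1)] K_carrier[OF kl(2)]
      K_carrier[OF kl'(1)] K_carrier[OF kl'(2)] K_carrier[OF l1(1)] K_carrier[OF l2(1)]
    have "p' \<otimes> X b n n \<otimes> q' = k \<otimes> (p \<otimes> (l \<otimes> X b n n) \<otimes> (l' \<otimes> q)) \<otimes> k'"
      by (simp add: kl kl' m_assoc)
    then have "DC a (p' \<otimes> X b n n \<otimes> q') c = DC a (p \<otimes> (l \<otimes> X b n n) \<otimes> (l' \<otimes> q)) c"
      by (simp add: DC_absorb)
    also have "p \<otimes> (l \<otimes> X b n n) \<otimes> (l' \<otimes> q) = p \<otimes> X b n n \<otimes> (l1 \<otimes> (l' \<otimes> q))"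
      unfolding l1 by (simp add: m_assoc)
    also have "\<dots> = p \<otimes> X b n n \<otimes> (l' \<otimes> q \<otimes> l1)"
      using elim l1 by metis
    also have "\<dots> = p \<otimes> (X b n n \<otimes> l') \<otimes> q \<otimes> l1"
      by (simp add: m_assoc)
    also have "\<dots> = p \<otimes> l2 \<otimes> X b n n \<otimes> q \<otimes> l1"
      unfolding l2 by (simp add: m_assoc)
    also have "\<dots> = l2 \<otimes> p \<otimes> X b n n \<otimes> q \<otimes> l1"
      using elim l2 by metis
    also have "\<dots> = l2 \<otimes> (p \<otimes> X b n n \<otimes> q) \<otimes> l1"
      by (simp add: m_assoc)
    finally show ?case by (simp add: DC_absorb)
  qed
qed

text \<open>This replaces the definite description by a formula in chosen representatives: stability
  gives a limiting value, and independence of representatives shows that it meets the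
  description.\<close>

lemma DC_prod_eventually:
  assumes p: "p \<in> carrier H" and q: "q \<in> carrier H"
  shows "\<forall>\<^sub>F n in sequentially. DC_prod a b c (DC a p b) (DC b q c) = DC a (p \<otimes> X b n n \<otimes> q) c"
proof -
  obtain N where N: "\<And>n. N \<le> n \<Longrightarrow> DC a (p \<otimes> X b n n \<otimes> q) c = DC a (p \<otimes> X b N N \<otimes> q) c"
    using DC_swap_stable[OF p q] by blast
  have "DC_prod a b c (DC a p b) (DC b q c) = DC a (p \<otimes> X b N N \<otimes> q) c"
    unfolding double_coset_prod_def
  proof (rule the_equality)
    show "\<forall>p'\<in>DC a p b. \<forall>q'\<in>DC b q c. \<exists>M. \<forall>n\<ge>M.
        DC a (p' \<otimes> X b n n \<otimes> q') c = DC a (p \<otimes> X b N N \<otimes> q) c"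
    proof (intro ballI)
      fix p' q' assume *: "p' \<in> DC a p b" "q' \<in> DC b q c"
      have "\<forall>\<^sub>F n in sequentially. DC a (p' \<otimes> X b n n \<otimes> q') c = DC a (p \<otimes> X b N N \<otimes> q) c"
        using DC_swap_representatives[OF p q *] eventually_ge_at_top[of N]
      proof eventually_elim
        case (elim n)
        show ?case using elim(1) N[OF elim(2)] by (rule trans)
      qed
      then show "\<exists>M. \<forall>n\<ge>M. DC a (p' \<otimes> X b n n \<otimes> q') c = DC a (p \<otimes> X b N N \<otimes> q) c"
        unfolding eventually_sequentially .
    qed
  next
    \<comment> \<open>\<open>p\<close> and \<open>q\<close> are themselves representatives, so any
      other candidate agrees with the limiting value at a common large \<open>n\<close>.\<close>
    fix R assume "\<forall>p'\<in>DC a p b. \<forall>q'\<in>DC b q c. \<exists>M. \<forall>n\<ge>M. DC a (p' \<otimes> X b n n \<otimes> q') c = R"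
    then obtain M where M: "\<And>n. n \<ge> M \<Longrightarrow> DC a (p \<otimes> X b n n \<otimes> q) c = R"
      using DC_self[OF p, of a b] DC_self[OF q, of b c] by blast
    show "R = DC a (p \<otimes> X b N N \<otimes> q) c"
      using M[of "max M N"] N[of "max M N"] by simp
  qed
  then show ?thesis
    unfolding eventually_sequentially using N[symmetric] by (intro exI[of _ N]) metis
qed

section \<open>Units, associativity and the category\<close>

lemma DC_prod_ex:
  assumes "p \<in> carrier H" "q \<in> carrier H"
  shows "\<exists>N. \<forall>n\<ge>N. DC_prod a b c (DC a p b) (DC b q c) = DC a (p \<otimes> X b n n \<otimes> q) c"
  using DC_prod_eventually[OF assms, of a b c] unfolding eventually_sequentially .

text \<open>With the identity as representative of the unit, the swap stands at the right end and is
  absorbed, since \<open>X b n n\<close> lies in \<open>K b\<close>.\<close>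

lemma DC_prod_unit_right:
  assumes "p \<in> carrier H"
  shows "DC_prod a b b (DC a p b) (DC b \<one> b) = DC a p b"
proof -
  obtain N where "\<forall>n\<ge>N.
      DC_prod a b b (DC a p b) (DC b \<one> b) = DC a (p \<otimes> X b n n \<otimes> \<one>) b"
    using DC_prod_ex[OF assms one_closed, of a b b] by blast
  then show ?thesis using assms by (auto simp: DC_absorb_right swap_in)
qed

lemma DC_prod_unit_left:
  assumes "q \<in> carrier H"
  shows "DC_prod b b c (DC b \<one> b) (DC b q c) = DC b q c"
proof -
  obtain N where "\<forall>n\<ge>N.
      DC_prod b b c (DC b \<one> b) (DC b q c) = DC b (\<one> \<otimes> X b n n \<otimes> q) c"
    using DC_prod_ex[OF one_closed assms, of b b c] by blast
  then show ?thesis using assms by (auto simp: DC_absorb_left swap_in)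
qed

text \<open>
  In \<open>p \<theta> q \<theta>' r\<close> the strands of \<open>p\<close> beyond \<open>b\<close> have to cross those of \<open>q\<close> and of \<open>r\<close>, and
  those of \<open>q\<close> beyond \<open>c\<close> only those of \<open>r\<close>. The two bracketings differ in which of \<open>\<theta>\<close> and
  \<open>\<theta>'\<close> performs the crossing of \<open>p\<close> with \<open>r\<close>, and both reduce to
  \<open>p X(b;s,s+u) q X(c;u,u) r\<close>.
\<close>

lemma
  assumes p: "p \<in> carrier H" "\<forall>x\<in>K N. p \<otimes> x = x \<otimes> p"
    and q: "q \<in> carrier H" "\<forall>x\<in>K N. q \<otimes> x = x \<otimes> q"
    and r: "r \<in> carrier H" "\<forall>x\<in>K N. r \<otimes> x = x \<otimes> r"
    and N: "a \<le> N" "d \<le> N" "N = b + s" "N = c + u"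
  shows DC_swap_assoc_left:
      "DC a (p \<otimes> X b s s \<otimes> q \<otimes> X c (u + s + e) (u + s + e) \<otimes> r) d
        = DC a (p \<otimes> X b s (s + u) \<otimes> q \<otimes> X c u u \<otimes> r) d"
    and DC_swap_assoc_right:
      "DC a (p \<otimes> X b (s + u + e) (s + u + e) \<otimes> (q \<otimes> X c u u \<otimes> r)) d
        = DC a (p \<otimes> X b s (s + u) \<otimes> q \<otimes> X c u u \<otimes> r) d"
proof -
  define A where "A = X b s s"
  define T where "T = X c u u"
  define V where "V = X N s u"
  define W where "W = X (N + s) e u"
  define Z where "Z = X N (u + s + e) (s + e)"
  have [simp]: "A \<in> carrier H" "T \<in> carrier H" "V \<in> carrier H" "W \<in> carrier H" "Z \<in> carrier H"
    by (simp_all add: A_def T_def V_def W_def Z_def)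
  have WK: "W \<in> K (N + s)" by (simp add: W_def swap_in)
  have K: "W \<in> K N" "V \<in> K N" "Z \<in> K N"
    using K_mono[OF WK] by (simp_all add: V_def Z_def swap_in)
  have AV: "X b s (s + u) = A \<otimes> V"
    using swap_add_right[of b s s u] N by (simp add: A_def V_def)
  have idx: "c + (u + s) = N + s" "c + u = N" using N by auto
  \<comment> \<open>The large swap at \<open>c\<close> is cut into four pieces: \<open>T\<close> is
    the small swap, \<open>V\<close> will complete \<open>A\<close> to the common form, and
    \<open>W\<close> and \<open>Z\<close> are to be absorbed at the two ends.\<close>
  have "X c (u + s + e) u = W \<otimes> (V \<otimes> T)"
    using swap_add_left[of c "u + s" e u] swap_add_left[of c u s u]
    by (simp only: idx W_def V_def T_def)
  then have X: "X c (u + s + e) (u + s + e) = W \<otimes> (V \<otimes> T) \<otimes> Z"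
    using swap_add_right[of c "u + s + e" u "s + e"] idx(2) by (simp add: Z_def add.assoc)
  \<comment> \<open>\<open>A\<close> involves only the \<open>2 * s\<close> strands after
    \<open>b\<close>, which end at \<open>N + s\<close>, exactly where \<open>W\<close>
    starts.\<close>
  have AW: "A \<otimes> W = W \<otimes> A"
    using swap_commute[of W b s s] WK N by (simp add: A_def)
  have "p \<otimes> A \<otimes> q \<otimes> (W \<otimes> (V \<otimes> T) \<otimes> Z) \<otimes> r = W \<otimes> (p \<otimes> (A \<otimes> V) \<otimes> q \<otimes> T \<otimes> r) \<otimes> Z"
    using p q r K AW
    by (simp add: m_assoc left_commute[of q W] left_commute[of A W] left_commute[of p W]
        left_commute[of q V])
  then show "DC a (p \<otimes> X b s s \<otimes> q \<otimes> X c (u + s + e) (u + s + e) \<otimes> r) d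
        = DC a (p \<otimes> X b s (s + u) \<otimes> q \<otimes> X c u u \<otimes> r) d"
    unfolding X AV A_def[symmetric] T_def[symmetric]
    using DC_absorb[of W a Z d] K K_mono N(1,2) p q r by simp
next
  define T where "T = X c u u"
  define B where "B = X b s (s + u)"
  define Y where "Y = X N (u + e) (s + u + e)"
  define Z where "Z = X (N + u) s e"
  have [simp]: "B \<in> carrier H" "T \<in> carrier H" "Y \<in> carrier H" "Z \<in> carrier H"
    by (simp_all add: B_def T_def Y_def Z_def)
  have ZK: "Z \<in> K (N + u)" by (simp add: Z_def swap_in)
  have K: "Y \<in> K N" "Z \<in> K N"
    using K_mono[OF ZK] by (simp_all add: Y_def swap_in)
  \<comment> \<open>Here the large swap is the one at \<open>b\<close>. \<open>Y\<close> goes to the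
    left end past \<open>p\<close>; \<open>Z\<close> starts at \<open>N + u\<close>, beyond the
    strands of \<open>T\<close>, and so reaches the right end.\<close>
  have X: "X b (s + u + e) (s + u + e) = Y \<otimes> (B \<otimes> Z)"
    using swap_add_left[of b s "u + e" "s + u + e"] swap_add_right[of b s "s + u" e] N(3)
    by (simp add: B_def Z_def Y_def add.assoc)
  have TZ: "T \<otimes> Z = Z \<otimes> T"
    using swap_commute[of Z c u u] ZK N by (simp add: T_def)
  have "p \<otimes> (Y \<otimes> (B \<otimes> Z)) \<otimes> (q \<otimes> T \<otimes> r) = Y \<otimes> (p \<otimes> (B \<otimes> (q \<otimes> (T \<otimes> (r \<otimes> Z)))))"
    using p q r K TZ
    by (simp add: m_assoc left_commute[of q Z] left_commute[of T Z] left_commute[of p Y])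
  also have "\<dots> = Y \<otimes> (p \<otimes> B \<otimes> q \<otimes> T \<otimes> r) \<otimes> Z"
    using p(1) q(1) r(1) by (simp add: m_assoc)
  finally show "DC a (p \<otimes> X b (s + u + e) (s + u + e) \<otimes> (q \<otimes> X c u u \<otimes> r)) d
        = DC a (p \<otimes> X b s (s + u) \<otimes> q \<otimes> X c u u \<otimes> r) d"
    unfolding X B_def[symmetric] T_def[symmetric]
    using DC_absorb[of Y a Z d] K K_mono N(1,2) p q r by simp
qed

lemma DC_prod_assoc:
  assumes "p \<in> carrier H" "q \<in> carrier H" "r \<in> carrier H"
  shows "DC_prod a c d (DC_prod a b c (DC a p b) (DC b q c)) (DC c r d)
    = DC_prod a b d (DC a p b) (DC_prod b c d (DC b q c) (DC c r d))"
proof -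
  obtain N1 where N1: "\<forall>n\<ge>N1.
      DC_prod a b c (DC a p b) (DC b q c) = DC a (p \<otimes> X b n n \<otimes> q) c"
    using DC_prod_ex[OF assms(1,2), of a b c] by blast
  obtain N2 where N2: "\<forall>n\<ge>N2.
      DC_prod b c d (DC b q c) (DC c r d) = DC b (q \<otimes> X c n n \<otimes> r) d"
    using DC_prod_ex[OF assms(2,3), of b c d] by blast
  have "\<forall>\<^sub>F n in sequentially. (\<forall>x\<in>K n. p \<otimes> x = x \<otimes> p) \<and> (\<forall>x\<in>K n. q \<otimes> x = x \<otimes> q)
      \<and> (\<forall>x\<in>K n. r \<otimes> x = x \<otimes> r) \<and> a + b + c + d + N1 + N2 \<le> n"
    by (intro eventually_conj commute_eventually assms eventually_ge_at_top)
  then obtain N where N: "\<forall>x\<in>K N. p \<otimes> x = x \<otimes> p" "\<forall>x\<in>K N. q \<otimes> x = x \<otimes> q"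
      "\<forall>x\<in>K N. r \<otimes> x = x \<otimes> r" "a + b + c + d + N1 + N2 \<le> N"
    unfolding eventually_sequentially by blast
  \<comment> \<open>The inner products are evaluated at sizes \<open>s\<close> and \<open>u\<close>
    with \<open>b + s = c + u = N\<close>. The outer ones are evaluated at \<open>u + s + e1\<close>
    and \<open>s + u + e2\<close>, which exceed their thresholds \<open>e1\<close> and
    \<open>e2\<close> and have the shape required by the two preceding lemmas.\<close>
  define s where "s = N - b"
  define u where "u = N - c"
  have su: "N = b + s" "N = c + u" "N1 \<le> s" "N2 \<le> u" "a \<le> N" "d \<le> N"
    using N(4) by (auto simp: s_def u_def)
  have cl: "p \<otimes> X b s s \<otimes> q \<in> carrier H" "q \<otimes> X c u u \<otimes> r \<in> carrier H" using assms by auto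
  obtain e1 where e1: "\<forall>n\<ge>e1. DC_prod a c d (DC a (p \<otimes> X b s s \<otimes> q) c) (DC c r d)
      = DC a (p \<otimes> X b s s \<otimes> q \<otimes> X c n n \<otimes> r) d"
    using DC_prod_ex[OF cl(1) assms(3), of a c d] by blast
  obtain e2 where e2: "\<forall>n\<ge>e2. DC_prod a b d (DC a p b) (DC b (q \<otimes> X c u u \<otimes> r) d)
      = DC a (p \<otimes> X b n n \<otimes> (q \<otimes> X c u u \<otimes> r)) d"
    using DC_prod_ex[OF assms(1) cl(2), of a b d] by blast
  show ?thesis
    unfolding N1[rule_format, OF su(3)] N2[rule_format, OF su(4)]
      e1[rule_format, of "u + s + e1", OF le_add2] e2[rule_format, of "s + u + e2", OF le_add2]
      DC_swap_assoc_left[OF assms(1) N(1) assms(2) N(2) assms(3) N(3) su(5,6,1,2)]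
      DC_swap_assoc_right[OF assms(1) N(1) assms(2) N(2) assms(3) N(3) su(5,6,1,2)] ..
qed

lemma DC_prod_closed:
  assumes "p \<in> carrier H" "q \<in> carrier H"
  shows "DC_prod a b c (DC a p b) (DC b q c) \<in> double_cosets H (K a) (K c)"
proof -
  obtain N where "\<forall>n\<ge>N.
      DC_prod a b c (DC a p b) (DC b q c) = DC a (p \<otimes> X b n n \<otimes> q) c"
    using DC_prod_ex[OF assms, of a b c] by blast
  then have "DC_prod a b c (DC a p b) (DC b q c) = DC a (p \<otimes> X b N N \<otimes> q) c" by blast
  then show ?thesis using assms by (auto simp: double_cosets_def)
qed

lemma is_category_double_coset_cat: "is_category (double_coset_cat H K (\<lambda>b n. X b n n))"
  unfolding is_category_def double_coset_cat_def
proof (simp, intro conjI allI ballI)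
  fix r show "DC r \<one> r \<in> double_cosets H (K r) (K r)"
    by (auto simp: double_cosets_def)
next
  fix r s t f g
  assume "f \<in> double_cosets H (K s) (K r)" "g \<in> double_cosets H (K t) (K s)"
  then show "DC_prod t s r g f \<in> double_cosets H (K t) (K r)"
    by (auto simp: double_cosets_def[of H "K t" "K s"] double_cosets_def[of H "K s" "K r"]
        DC_prod_closed)
next
  fix r s f
  assume "f \<in> double_cosets H (K s) (K r)"
  then show "DC_prod s s r (DC s \<one> s) f = f" "DC_prod s r r f (DC r \<one> r) = f"
    by (auto simp: double_cosets_def DC_prod_unit_left DC_prod_unit_right)
next
  fix q r s t f g h
  assume "f \<in> double_cosets H (K r) (K q)" "g \<in> double_cosets H (K s) (K r)"
    "h \<in> double_cosets H (K t) (K s)"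
  then show "DC_prod t s q h (DC_prod s r q g f) = DC_prod t r q (DC_prod t s r h g) f"
    by (auto simp: double_cosets_def DC_prod_assoc)
qed

end

section \<open>Functors induced by homomorphisms between block swap systems\<close>

lemma double_coset_functor:
  assumes "block_swap_system H K X" "block_swap_system H' K' X'"
    and hom: "\<phi> \<in> hom H H'"
    and K: "\<And>n. \<phi> ` K n \<subseteq> K' n"
    and X: "\<And>b n. \<phi> (X b n n) = X' b n n"
  shows "\<exists>F. (\<forall>r s. \<forall>g\<in>carrier H. F r s (double_coset H (K s) g (K r)) =
           double_coset H' (K' s) (\<phi> g) (K' r)) \<and>
     is_functor (double_coset_cat H K (\<lambda>b n. X b n n)) (double_coset_cat H' K' (\<lambda>b n. X' b n n))
       (\<lambda>r. r) F"
proof -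
  interpret H: block_swap_system H K X by fact
  interpret H': block_swap_system H' K' X' by fact
  interpret \<phi>: group_hom H H' \<phi> using hom by unfold_locales
  \<comment> \<open>A morphism is a bare set, so a representative has to be chosen. The next step
    shows that the choice is harmless, because \<open>\<phi>\<close> maps \<open>K\<close> into
    \<open>K'\<close>.\<close>
  define F where "F r s P = H'.DC s (\<phi> (SOME g. g \<in> P)) r" for r s P
  have F: "F r s (H.DC s g r) = H'.DC s (\<phi> g) r" if g: "g \<in> carrier H" for r s g
  proof -
    have "(SOME x. x \<in> H.DC s g r) \<in> H.DC s g r" using H.DC_self[OF g] by (rule someI)
    then obtain k l where *: "k \<in> K s" "l \<in> K r"
      "(SOME x. x \<in> H.DC s g r) = k \<otimes>\<^bsub>H\<^esub> g \<otimes>\<^bsub>H\<^esub> l"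
      unfolding H.DC_iff by blast
    then have "\<phi> k \<in> K' s" "\<phi> l \<in> K' r" using K by auto
    then show ?thesis using * g by (simp add: F_def H'.DC_absorb)
  qed
  have comp: "F r t (H.DC_prod t s r (H.DC t g s) (H.DC s f r)) =
      H'.DC_prod t s r (F s t (H.DC t g s)) (F r s (H.DC s f r))"
    if fg: "f \<in> carrier H" "g \<in> carrier H" for r s t f g
  proof -
    obtain M where M: "\<forall>n\<ge>M.
        H.DC_prod t s r (H.DC t g s) (H.DC s f r) = H.DC t (g \<otimes>\<^bsub>H\<^esub> X s n n \<otimes>\<^bsub>H\<^esub> f) r"
      using H.DC_prod_ex[OF fg(2,1), of t s r] by blast
    obtain N where N: "\<forall>n\<ge>N.
        H'.DC_prod t s r (H'.DC t (\<phi> g) s) (H'.DC s (\<phi> f) r)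
          = H'.DC t (\<phi> g \<otimes>\<^bsub>H'\<^esub> X' s n n \<otimes>\<^bsub>H'\<^esub> \<phi> f) r"
      using H'.DC_prod_ex[OF \<phi>.hom_closed[OF fg(2)] \<phi>.hom_closed[OF fg(1)], of t s r] by blast
    \<comment> \<open>At the common index \<open>max M N\<close> both products have reached their
      limiting values, and \<open>\<phi>\<close> carries the first representative to the
      second.\<close>
    show ?thesis
      using M[rule_format, of "max M N"] N[rule_format, of "max M N"] fg by (simp add: F X)
  qed
  have "is_functor (double_coset_cat H K (\<lambda>b n. X b n n)) (double_coset_cat H' K' (\<lambda>b n. X' b n n))
       (\<lambda>r. r) F"
    unfolding is_functor_def
    using H.is_category_double_coset_cat H'.is_category_double_coset_cat
    by (auto simp: double_coset_cat_def double_cosets_def F comp)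
  then show ?thesis using F by blast
qed

section \<open>Block swaps in the braid group\<close>

text \<open>Letting the number of factors differ from their length is what makes additivity in each
  index separately expressible.\<close>

definition braid_swap :: "nat \<Rightarrow> nat \<Rightarrow> nat \<Rightarrow> braid" where
  "braid_swap b m n = list_prod B_inf (map (tau b m) [0..<n])"

lemma theta_eq_swap: "theta b n = braid_swap b n n"
  by (simp add: theta_def braid_swap_def)

section \<open>Products of generators and additivity on the right\<close>

interpretation B: group B_inf by (rule group_B_inf)

lemma B_carrier [simp]: "x \<in> carrier B_inf"
  by (simp add: B_inf_def)

lemma list_prod_Nil [simp]: "list_prod B_inf [] = \<one>\<^bsub>B_inf\<^esub>"
  by (simp add: list_prod_def)

lemma list_prod_Cons [simp]: "list_prod B_inf (x # xs) = x \<otimes>\<^bsub>B_inf\<^esub> list_prod B_inf xs"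
  by (simp add: list_prod_def)

lemma list_prod_append:
  "list_prod B_inf (xs @ ys) = list_prod B_inf xs \<otimes>\<^bsub>B_inf\<^esub> list_prod B_inf ys"
  by (induction xs) (simp_all add: B.m_assoc)

lemma tau_0 [simp]: "tau b 0 i = \<one>\<^bsub>B_inf\<^esub>"
  by (simp add: tau_def)

lemma tau_Suc: "tau b (Suc m) i = sigma (b + i + Suc m) \<otimes>\<^bsub>B_inf\<^esub> tau b m i"
  by (simp add: tau_def ac_simps)

lemma tau_add: "tau b (m1 + m2) i = tau (b + m1) m2 i \<otimes>\<^bsub>B_inf\<^esub> tau b m1 i"
  by (induction m2) (simp_all add: tau_Suc B.m_assoc ac_simps)

lemma tau_shift: "tau b m (n + i) = tau (b + n) m i"
  by (induction m) (simp_all add: tau_Suc ac_simps)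

lemma braid_swap_0 [simp]: "braid_swap b m 0 = \<one>\<^bsub>B_inf\<^esub>"
  by (simp add: braid_swap_def)

lemma braid_swap_Suc: "braid_swap b m (Suc n) = braid_swap b m n \<otimes>\<^bsub>B_inf\<^esub> tau (b + n) m 0"
  using tau_shift[of b m n 0] by (simp add: braid_swap_def list_prod_append)

lemma braid_swap_add_right:
  "braid_swap b m (n1 + n2) = braid_swap b m n1 \<otimes>\<^bsub>B_inf\<^esub> braid_swap (b + n1) m n2"
  by (induction n2) (simp_all add: braid_swap_Suc B.m_assoc add.assoc)

section \<open>The subgroups \<open>B_sub\<close> and induction over them\<close>

lemma subgroup_B_sub: "subgroup (B_sub n) B_inf"
  unfolding B_sub_def by (rule B.generate_is_subgroup) auto

lemma B_sub_mult: "x \<in> B_sub n \<Longrightarrow> y \<in> B_sub n \<Longrightarrow> x \<otimes>\<^bsub>B_inf\<^esub> y \<in> B_sub n"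
  by (rule subgroup.m_closed[OF subgroup_B_sub])

lemma B_sub_one: "\<one>\<^bsub>B_inf\<^esub> \<in> B_sub n"
  by (rule subgroup.one_closed[OF subgroup_B_sub])

lemma B_sub_inv: "x \<in> B_sub n \<Longrightarrow> inv\<^bsub>B_inf\<^esub> x \<in> B_sub n"
  by (rule subgroup.m_inv_closed[OF subgroup_B_sub])

lemma B_sub_antimono: "m \<le> n \<Longrightarrow> B_sub n \<subseteq> B_sub m"
  unfolding B_sub_def by (rule B.mono_generate) auto

lemma sigma_in_B_sub: "b < j \<Longrightarrow> sigma j \<in> B_sub b"
  unfolding B_sub_def by (rule generate.incl) auto

text \<open>\<open>generate\<close> inverts generators only. Asking for closure under all inverses
  costs nothing in the applications and lets the inverse case follow from the induction
  hypothesis.\<close>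

lemma B_sub_induct [consumes 1, case_names one gen inv mult]:
  assumes "x \<in> B_sub b"
    and "P \<one>\<^bsub>B_inf\<^esub>"
    and gen: "\<And>j. b < j \<Longrightarrow> P (sigma j)"
    and inv: "\<And>x. x \<in> B_sub b \<Longrightarrow> P x \<Longrightarrow> P (inv\<^bsub>B_inf\<^esub> x)"
    and "\<And>x y. x \<in> B_sub b \<Longrightarrow> y \<in> B_sub b \<Longrightarrow> P x \<Longrightarrow> P y \<Longrightarrow> P (x \<otimes>\<^bsub>B_inf\<^esub> y)"
  shows "P x"
  using assms(1) unfolding B_sub_def
proof (induction rule: generate.induct)
  case (inv h)
  then obtain j where "h = sigma j" "b < j" by auto
  then show ?case using gen assms(4) sigma_in_B_sub by blast
qed (use assms(2,3,5) in \<open>auto simp: B_sub_def\<close>)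

lemma tau_in_B_sub: "tau b m i \<in> B_sub (b + i)"
  by (induction m) (auto simp: tau_Suc B_sub_one intro!: B_sub_mult sigma_in_B_sub)

lemma braid_swap_in: "braid_swap b m n \<in> B_sub b"
proof (induction n)
  case (Suc n)
  then show ?case
    using tau_in_B_sub[of "b + n" m 0] B_sub_antimono[of b "b + n"]
    by (auto simp: braid_swap_Suc intro!: B_sub_mult)
qed (simp add: B_sub_one)

section \<open>Commutation of distant braids and additivity on the left\<close>

definition commutes :: "braid \<Rightarrow> braid \<Rightarrow> bool" where
  "commutes x y \<longleftrightarrow> x \<otimes>\<^bsub>B_inf\<^esub> y = y \<otimes>\<^bsub>B_inf\<^esub> x"

lemma commutes_sym: "commutes x y \<Longrightarrow> commutes y x"
  by (simp add: commutes_def)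

lemma commutes_one: "commutes x \<one>\<^bsub>B_inf\<^esub>"
  by (simp add: commutes_def)

lemma commutes_mult: "commutes x y \<Longrightarrow> commutes x z \<Longrightarrow> commutes x (y \<otimes>\<^bsub>B_inf\<^esub> z)"
  unfolding commutes_def by (metis B.m_assoc B_carrier)

lemma commutes_inv: "commutes x y \<Longrightarrow> commutes x (inv\<^bsub>B_inf\<^esub> y)"
  unfolding commutes_def
  by (metis B.inv_solve_left B.inv_solve_right' B.m_assoc B_carrier)

text \<open>Positivity of \<open>i\<close> matters: since \<open>sigma 0\<close> equals
  \<open>sigma 1\<close>, the case \<open>i = 0\<close>, \<open>j = 2\<close> would claim that
  \<open>sigma 1\<close> and \<open>sigma 2\<close> commute.\<close>

lemma sigma_far: "0 < i \<Longrightarrow> i + 2 \<le> j \<Longrightarrow> commutes (sigma i) (sigma j)"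
  unfolding commutes_def B_inf_def
  by simp (transfer, simp add: braid_eq.braid_far)

lemma sigma_near:
  assumes "0 < i"
  shows "sigma i \<otimes>\<^bsub>B_inf\<^esub> (sigma (Suc i) \<otimes>\<^bsub>B_inf\<^esub> sigma i)
    = sigma (Suc i) \<otimes>\<^bsub>B_inf\<^esub> (sigma i \<otimes>\<^bsub>B_inf\<^esub> sigma (Suc i))"
  using assms braid_eq.braid_near
  unfolding B_inf_def by simp (transfer, metis One_nat_def Suc_eq_plus1 Suc_pred append_Cons append_Nil diff_Suc_1)

lemma sigma_commutes_B_sub:
  assumes "x \<in> B_sub j" "0 < i" "i < j"
  shows "commutes (sigma i) x"
  using assms(1)
  by (induction rule: B_sub_induct)
    (use assms(2,3) in \<open>auto intro: commutes_one commutes_mult commutes_inv sigma_far\<close>)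

text \<open>The largest index in \<open>tau b m i\<close> is \<open>b + i + m\<close> and the
  smallest generator of this subgroup has index \<open>b + i + m + 2\<close>, which is just the gap
  demanded by \<open>sigma_far\<close>.\<close>

lemma tau_commutes_B_sub:
  assumes "x \<in> B_sub (b + i + Suc m)"
  shows "commutes x (tau b m i)"
  using assms
proof (induction m)
  case (Suc m)
  then have "x \<in> B_sub (b + i + Suc m)"
    using B_sub_antimono[of "b + i + Suc m" "b + i + Suc (Suc m)"] by auto
  then show ?case
    using Suc sigma_commutes_B_sub[OF Suc.prems, of "b + i + Suc m"]
    by (auto simp: tau_Suc intro: commutes_mult commutes_sym)
qed (simp add: commutes_one)

lemma braid_swap_commutes:
  assumes "x \<in> B_sub (b + m + n)"
  shows "commutes x (braid_swap b m n)"
  using assms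
proof (induction n)
  case (Suc n)
  then have "x \<in> B_sub (b + m + n)"
    using B_sub_antimono[of "b + m + n" "b + m + Suc n"] by auto
  moreover have "x \<in> B_sub ((b + n) + 0 + Suc m)" using Suc.prems by (simp add: ac_simps)
  ultimately show ?case
    using Suc.IH tau_commutes_B_sub by (auto simp: braid_swap_Suc intro: commutes_mult)
qed (simp add: commutes_one)

text \<open>The swap is built along \<open>n\<close>. In each new factor \<open>tau_add\<close>
  separates a part \<open>?A\<close> using only strands after \<open>b + m1 + n\<close>; these are
  untouched by \<open>braid_swap b m1 n\<close>, so \<open>?A\<close> joins the left factor.\<close>

lemma braid_swap_add_left:
  "braid_swap b (m1 + m2) n = braid_swap (b + m1) m2 n \<otimes>\<^bsub>B_inf\<^esub> braid_swap b m1 n"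
proof (induction n)
  case (Suc n)
  let ?A = "tau (b + m1 + n) m2 0" and ?B = "tau (b + n) m1 0"
  have "commutes ?A (braid_swap b m1 n)"
    using tau_in_B_sub[of "b + m1 + n" m2 0] by (intro braid_swap_commutes) simp
  then have "braid_swap b m1 n \<otimes>\<^bsub>B_inf\<^esub> (?A \<otimes>\<^bsub>B_inf\<^esub> ?B) = ?A \<otimes>\<^bsub>B_inf\<^esub> (braid_swap b m1 n \<otimes>\<^bsub>B_inf\<^esub> ?B)"
    unfolding commutes_def by (metis B.m_assoc B_carrier)
  then show ?case
    using tau_add[of "b + n" m1 m2 0]
    by (simp add: braid_swap_Suc Suc B.m_assoc ac_simps)
qed simp

section \<open>Sliding generators through block swaps\<close>

lemma braid_swap_m_1: "braid_swap b m 1 = tau b m 0"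
  by (simp add: braid_swap_def)

lemma braid_swap_1_1: "braid_swap b 1 1 = sigma (Suc b)"
  using tau_Suc[of b 0 0] unfolding braid_swap_m_1 by simp

text \<open>\<open>sigma k\<close> commutes with the leading letters of the descending word until it
  meets \<open>sigma (Suc k)\<close> followed by \<open>sigma k\<close>. The braid relation there
  turns it into \<open>sigma (Suc k)\<close>, which commutes with the remaining letters.\<close>

lemma sigma_tau:
  assumes "b < k" "k < b + m"
  shows "sigma k \<otimes>\<^bsub>B_inf\<^esub> tau b m 0 = tau b m 0 \<otimes>\<^bsub>B_inf\<^esub> sigma (Suc k)"
  using assms
proof (induction m)
  case (Suc m)
  show ?case
  proof (cases "k < b + m")
    case True
    have "commutes (sigma k) (sigma (b + Suc m))"
      using True Suc.prems by (intro sigma_far) auto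
    then have "sigma k \<otimes>\<^bsub>B_inf\<^esub> tau b (Suc m) 0 = sigma (b + Suc m) \<otimes>\<^bsub>B_inf\<^esub> (sigma k \<otimes>\<^bsub>B_inf\<^esub> tau b m 0)"
      by (simp add: tau_Suc commutes_def flip: B.m_assoc)
    then show ?thesis using Suc.IH True Suc.prems by (simp add: tau_Suc B.m_assoc)
  next
    case False
    with Suc.prems have k: "k = b + m" by simp
    with Suc.prems obtain m' where m: "m = Suc m'" by (cases m) auto
    have "commutes (sigma (Suc k)) (tau b m' 0)"
      using k m by (intro tau_commutes_B_sub sigma_in_B_sub) simp
    then have *: "tau b m' 0 \<otimes>\<^bsub>B_inf\<^esub> sigma (Suc k) = sigma (Suc k) \<otimes>\<^bsub>B_inf\<^esub> tau b m' 0"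
      by (simp add: commutes_def)
    have "tau b (Suc m) 0 = sigma (Suc k) \<otimes>\<^bsub>B_inf\<^esub> (sigma k \<otimes>\<^bsub>B_inf\<^esub> tau b m' 0)"
      by (simp add: m k tau_Suc)
    then show ?thesis
      using sigma_near[of k] Suc.prems * by (simp add: B.m_assoc) (simp flip: B.m_assoc)
  qed
qed simp

text \<open>Each of the \<open>n\<close> factors \<open>tau\<close> raises the index by one.\<close>

lemma sigma_swap:
  assumes "b < k" "k < b + m"
  shows "sigma k \<otimes>\<^bsub>B_inf\<^esub> braid_swap b m n = braid_swap b m n \<otimes>\<^bsub>B_inf\<^esub> sigma (k + n)"
proof (induction n)
  case (Suc n)
  have "sigma (k + n) \<otimes>\<^bsub>B_inf\<^esub> tau (b + n) m 0 = tau (b + n) m 0 \<otimes>\<^bsub>B_inf\<^esub> sigma (k + Suc n)"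
    using sigma_tau[of "b + n" "k + n" m] assms by simp
  with Suc show ?case
    unfolding braid_swap_Suc by (metis B.m_assoc B_carrier)
qed simp

text \<open>The mirror image of \<open>sigma_tau\<close>: the row is the ascending word from
  \<open>sigma (b + 1)\<close> to \<open>sigma (b + n)\<close>, and the generator enters from its
  right end.\<close>

lemma braid_swap_row_sigma:
  assumes "b < k" "k < b + n"
  shows "braid_swap b 1 n \<otimes>\<^bsub>B_inf\<^esub> sigma k = sigma (Suc k) \<otimes>\<^bsub>B_inf\<^esub> braid_swap b 1 n"
  using assms
proof (induction n)
  case (Suc n)
  have tau1: "tau (b + n) 1 0 = sigma (Suc (b + n))"
    using tau_Suc[of "b + n" 0 0] by simp
  show ?case
  proof (cases "k < b + n")
    case True
    have "commutes (sigma k) (sigma (Suc (b + n)))"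
      using True Suc.prems by (intro sigma_far) auto
    then have "braid_swap b 1 (Suc n) \<otimes>\<^bsub>B_inf\<^esub> sigma k
        = (braid_swap b 1 n \<otimes>\<^bsub>B_inf\<^esub> sigma k) \<otimes>\<^bsub>B_inf\<^esub> sigma (Suc (b + n))"
      by (simp add: braid_swap_Suc tau1[simplified] commutes_def B.m_assoc)
    then show ?thesis
      using Suc.IH True Suc.prems by (simp add: braid_swap_Suc tau1[simplified] flip: B.m_assoc)
  next
    case False
    with Suc.prems have k: "k = b + n" by simp
    with Suc.prems obtain n' where n: "n = Suc n'" by (cases n) auto
    have "commutes (sigma (Suc k)) (braid_swap b 1 n')"
      using k n by (intro braid_swap_commutes sigma_in_B_sub) simp
    then have *: "braid_swap b 1 n' \<otimes>\<^bsub>B_inf\<^esub> sigma (Suc k) = sigma (Suc k) \<otimes>\<^bsub>B_inf\<^esub> braid_swap b 1 n'"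
      by (simp add: commutes_def)
    have "tau (b + n') 1 0 = sigma k" using tau_Suc[of "b + n'" 0 0] k n by simp
    then have "braid_swap b 1 (Suc n) = braid_swap b 1 n' \<otimes>\<^bsub>B_inf\<^esub> sigma k \<otimes>\<^bsub>B_inf\<^esub> sigma (Suc k)"
      using tau1 by (simp add: n k braid_swap_Suc)
    moreover have "sigma k \<otimes>\<^bsub>B_inf\<^esub> sigma (Suc k) \<otimes>\<^bsub>B_inf\<^esub> sigma k
        = sigma (Suc k) \<otimes>\<^bsub>B_inf\<^esub> (sigma k \<otimes>\<^bsub>B_inf\<^esub> sigma (Suc k))"
      using sigma_near[of k] Suc.prems by (simp add: B.m_assoc)
    ultimately show ?thesis
      using * by (metis B.m_assoc B_carrier)
  qed
qed simp

text \<open>From the right the swap has to be read as a stack of \<open>m\<close> rows, which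
  \<open>braid_swap_add_left\<close> supplies; each row raises the index by one.\<close>

lemma swap_sigma:
  assumes "b < k" "k < b + n"
  shows "braid_swap b m n \<otimes>\<^bsub>B_inf\<^esub> sigma k = sigma (k + m) \<otimes>\<^bsub>B_inf\<^esub> braid_swap b m n"
proof (induction m)
  case 0
  have "braid_swap b 0 n = \<one>\<^bsub>B_inf\<^esub>" by (induction n) (simp_all add: braid_swap_Suc)
  then show ?case by simp
next
  case (Suc m)
  have "braid_swap (b + m) 1 n \<otimes>\<^bsub>B_inf\<^esub> sigma (k + m) = sigma (k + Suc m) \<otimes>\<^bsub>B_inf\<^esub> braid_swap (b + m) 1 n"
    using braid_swap_row_sigma[of "b + m" "k + m" n] assms by simp
  with Suc show ?case
    using braid_swap_add_left[of b m 1 n] by (metis B.m_assoc B_carrier Suc_eq_plus1)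
qed

text \<open>Only generators carry content. For fixed \<open>n\<close> the property passes to
  inverses and products, and finitely many thresholds for \<open>n\<close> combine.\<close>

lemma braid_pass_right:
  assumes "k \<in> B_sub b"
  shows "\<forall>\<^sub>F n in sequentially. \<exists>k'\<in>B_sub (b + n).
    k \<otimes>\<^bsub>B_inf\<^esub> braid_swap b n n = braid_swap b n n \<otimes>\<^bsub>B_inf\<^esub> k'"
  using assms
proof (induction rule: B_sub_induct)
  case one
  show ?case by (intro always_eventually allI bexI[OF _ B_sub_one]) simp
next
  case (gen j)
  \<comment> \<open>\<open>n > j\<close> puts \<open>j\<close> in the range from \<open>b\<close> to
    \<open>b + n\<close> where \<open>sigma_swap\<close> applies.\<close>
  show ?case using eventually_gt_at_top[of j]
  proof eventually_elim
    case (elim n)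
    then show ?case using sigma_swap[of b j n n] gen
      by (intro bexI[of _ "sigma (j + n)"]) (auto intro: sigma_in_B_sub)
  qed
next
  case (inv x)
  show ?case using inv(2)
  proof eventually_elim
    case (elim n)
    then obtain k' where "k' \<in> B_sub (b + n)"
      "x \<otimes>\<^bsub>B_inf\<^esub> braid_swap b n n = braid_swap b n n \<otimes>\<^bsub>B_inf\<^esub> k'" by blast
    then have "inv\<^bsub>B_inf\<^esub> x \<otimes>\<^bsub>B_inf\<^esub> braid_swap b n n = braid_swap b n n \<otimes>\<^bsub>B_inf\<^esub> inv\<^bsub>B_inf\<^esub> k'"
      by (metis B.inv_solve_left B.inv_solve_right B.m_assoc B_carrier)
    then show ?case using B_sub_inv \<open>k' \<in> _\<close> by blast
  qed
next
  case (mult x y)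
  show ?case using mult(3,4)
  proof eventually_elim
    case (elim n)
    then obtain k l where "k \<in> B_sub (b + n)" "l \<in> B_sub (b + n)"
      "x \<otimes>\<^bsub>B_inf\<^esub> braid_swap b n n = braid_swap b n n \<otimes>\<^bsub>B_inf\<^esub> k"
      "y \<otimes>\<^bsub>B_inf\<^esub> braid_swap b n n = braid_swap b n n \<otimes>\<^bsub>B_inf\<^esub> l" by blast
    then have "x \<otimes>\<^bsub>B_inf\<^esub> y \<otimes>\<^bsub>B_inf\<^esub> braid_swap b n n = braid_swap b n n \<otimes>\<^bsub>B_inf\<^esub> (k \<otimes>\<^bsub>B_inf\<^esub> l)"
      by (metis B.m_assoc B_carrier)
    then show ?case using B_sub_mult \<open>k \<in> _\<close> \<open>l \<in> _\<close> by blast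
  qed
qed

lemma braid_pass_left:
  assumes "k \<in> B_sub b"
  shows "\<forall>\<^sub>F n in sequentially. \<exists>k'\<in>B_sub (b + n).
    braid_swap b n n \<otimes>\<^bsub>B_inf\<^esub> k = k' \<otimes>\<^bsub>B_inf\<^esub> braid_swap b n n"
  using assms
proof (induction rule: B_sub_induct)
  case one
  show ?case by (intro always_eventually allI bexI[OF _ B_sub_one]) simp
next
  case (gen j)
  show ?case using eventually_gt_at_top[of j]
  proof eventually_elim
    case (elim n)
    then show ?case using swap_sigma[of b j n n] gen
      by (intro bexI[of _ "sigma (j + n)"]) (auto intro: sigma_in_B_sub)
  qed
next
  case (inv x)
  show ?case using inv(2)
  proof eventually_elim
    case (elim n)
    then obtain k' where "k' \<in> B_sub (b + n)"
      "braid_swap b n n \<otimes>\<^bsub>B_inf\<^esub> x = k' \<otimes>\<^bsub>B_inf\<^esub> braid_swap b n n" by blast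
    then have "braid_swap b n n \<otimes>\<^bsub>B_inf\<^esub> inv\<^bsub>B_inf\<^esub> x = inv\<^bsub>B_inf\<^esub> k' \<otimes>\<^bsub>B_inf\<^esub> braid_swap b n n"
      by (metis B.inv_solve_left B.inv_solve_right B.m_assoc B_carrier)
    then show ?case using B_sub_inv \<open>k' \<in> _\<close> by blast
  qed
next
  case (mult x y)
  show ?case using mult(3,4)
  proof eventually_elim
    case (elim n)
    then obtain k l where "k \<in> B_sub (b + n)" "l \<in> B_sub (b + n)"
      "braid_swap b n n \<otimes>\<^bsub>B_inf\<^esub> x = k \<otimes>\<^bsub>B_inf\<^esub> braid_swap b n n"
      "braid_swap b n n \<otimes>\<^bsub>B_inf\<^esub> y = l \<otimes>\<^bsub>B_inf\<^esub> braid_swap b n n" by blast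
    then have "braid_swap b n n \<otimes>\<^bsub>B_inf\<^esub> (x \<otimes>\<^bsub>B_inf\<^esub> y) = (k \<otimes>\<^bsub>B_inf\<^esub> l) \<otimes>\<^bsub>B_inf\<^esub> braid_swap b n n"
      by (metis B.m_assoc B_carrier)
    then show ?case using B_sub_mult \<open>k \<in> _\<close> \<open>l \<in> _\<close> by blast
  qed
qed

text \<open>This makes \<open>B_sub_induct\<close> an induction principle for all braids.\<close>

lemma B_sub_0: "p \<in> B_sub 0"
proof -
  have "abs_braid w \<in> B_sub 0" for w
  proof (induction w)
    case Nil
    have "abs_braid [] = \<one>\<^bsub>B_inf\<^esub>" by (simp add: B_inf_def braid_one.abs_eq)
    then show ?case by (simp add: B_sub_one)
  next
    case (Cons l w)
    obtain i e where l: "l = (i, e)" by (cases l)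
    \<comment> \<open>Letters count from 0 and generators from 1, hence the successor.\<close>
    have T: "abs_braid [(i, True)] = sigma (Suc i)" by (simp add: sigma.abs_eq)
    have "abs_braid [(i, True)] \<otimes>\<^bsub>B_inf\<^esub> abs_braid [(i, False)] = \<one>\<^bsub>B_inf\<^esub>"
      using braid_eq.braid_cancel[of i True]
      by (simp add: B_inf_def braid_mult.abs_eq braid_one.abs_eq braid.abs_eq_iff)
    then have "abs_braid [(i, False)] = inv\<^bsub>B_inf\<^esub> sigma (Suc i)"
      unfolding T by (metis B.inv_equality B.inv_inv B_carrier)
    then have "abs_braid [(i, e)] \<in> B_sub 0"
      using T by (cases e) (simp_all add: sigma_in_B_sub B_sub_inv)
    moreover have "abs_braid (l # w) = abs_braid [(i, e)] \<otimes>\<^bsub>B_inf\<^esub> abs_braid w"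
      by (simp add: B_inf_def braid_mult.abs_eq l)
    ultimately show ?case using Cons B_sub_mult by simp
  qed
  then show ?thesis by (induction p rule: braid.abs_induct) simp
qed

text \<open>The generator \<open>sigma j\<close> commutes with \<open>B_sub (Suc j)\<close>;
  products take the maximum of two thresholds.\<close>

lemma braid_commute_ex: "\<exists>N. \<forall>x\<in>B_sub N. commutes x p"
  using B_sub_0[of p]
proof (induction rule: B_sub_induct)
  case (gen j)
  show ?case
    using sigma_commutes_B_sub[of _ "Suc j" j] gen by (auto intro: commutes_sym)
next
  case (mult x y)
  then obtain M N where "\<forall>z\<in>B_sub M. commutes z x" "\<forall>z\<in>B_sub N. commutes z y" by blast
  then have "\<forall>z\<in>B_sub (max M N). commutes z (x \<otimes>\<^bsub>B_inf\<^esub> y)"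
    using B_sub_antimono[of M "max M N"] B_sub_antimono[of N "max M N"]
    by (auto intro!: commutes_mult)
  then show ?case ..
qed (auto intro: commutes_one commutes_inv)

section \<open>Block swaps in \<open>GL(\<infinity>)\<close>\<close>

lemma mat_mult_id_row: "(\<And>k. A i k = id_mat i k) \<Longrightarrow> mat_mult A B i j = B i j"
  using mat_mult_id_left[of B] by (metis (no_types, lifting) ext mat_mult_def)

lemma mat_mult_id_col: "(\<And>k. B k j = id_mat k j) \<Longrightarrow> mat_mult A B i j = A i j"
  using mat_mult_id_right[of A] by (simp add: mat_mult_def fun_eq_iff)

lemma mat_mult_eq_0: "(\<And>k. A i k = 0 \<or> B k j = 0) \<Longrightarrow> mat_mult A B i j = 0"
proof -
  assume "\<And>k. A i k = 0 \<or> B k j = 0"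
  then have "(\<lambda>k. A i k * B k j) = (\<lambda>k. 0)" by (auto simp: fun_eq_iff)
  then show ?thesis by (simp only: mat_mult_def Sum_any.neutral)
qed

lemma row_times_mat_eq_mult: "row_times_mat x A = mat_mult (\<lambda>_. x) A i"
  by (simp add: row_times_mat_def mat_mult_def)

lemma mat_times_col_eq_mult: "mat_times_col A x i = mat_mult A (\<lambda>k _. x k) i j"
  by (simp add: mat_times_col_def mat_mult_def)

lemma row_times_mat_eq_sum:
  assumes "bounded_mat N A" "N \<le> M" "j < M"
  shows "row_times_mat x A j = (\<Sum>i<M. x i * A i j)"
  unfolding row_times_mat_def
proof (rule Sum_any.expand_superset)
  show "{i. x i * A i j \<noteq> 0} \<subseteq> {..<M}"
  proof clarify
    fix i assume nz: "x i * A i j \<noteq> 0"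
    show "i < M"
    proof (rule ccontr)
      assume "\<not> i < M"
      then have "A i j = id_mat i j" "i \<noteq> j" using assms by (auto simp: bounded_mat_def)
      with nz show False by (simp add: id_mat_def)
    qed
  qed
qed simp

text \<open>As a matrix with all rows equal, \<open>x\<close> is not finitary, so it cannot be the
  first factor in \<open>mat_mult_assoc\<close> and the sums are exchanged by hand. In
  \<open>mat_times_col_mult\<close> the vector takes the unrestricted third place instead.\<close>

lemma row_times_mat_mult:
  assumes "finitary A" "finitary B"
  shows "row_times_mat x (mat_mult A B) = row_times_mat (row_times_mat x A) B"
proof
  fix j
  obtain N where A: "bounded_mat N A" and B: "bounded_mat N B"
    using assms by (rule common_bound)
  define M where "M = Suc (N + j)"
  have M: "N \<le> M" "j < M" by (auto simp: M_def)
  have "row_times_mat x (mat_mult A B) j = (\<Sum>i<M. x i * (\<Sum>k<M. A i k * B k j))"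
    unfolding row_times_mat_eq_sum[OF bounded_mat_mult[OF A B] M]
    by (intro sum.cong refl) (simp add: mat_mult_eq_sum[OF A M(1)])
  also have "\<dots> = (\<Sum>i<M. \<Sum>k<M. x i * A i k * B k j)"
    by (simp add: sum_distrib_left mult.assoc)
  also have "\<dots> = (\<Sum>k<M. \<Sum>i<M. x i * A i k * B k j)" by (rule sum.swap)
  also have "\<dots> = (\<Sum>k<M. row_times_mat x A k * B k j)"
    by (intro sum.cong refl) (simp add: row_times_mat_eq_sum[OF A M(1)] sum_distrib_right)
  also have "\<dots> = row_times_mat (row_times_mat x A) B j"
    by (rule row_times_mat_eq_sum[OF B M, symmetric])
  finally show "row_times_mat x (mat_mult A B) j = row_times_mat (row_times_mat x A) B j" .
qed

lemma mat_times_col_mult: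
  assumes "finitary A" "finitary B"
  shows "mat_times_col (mat_mult A B) x = mat_times_col A (mat_times_col B x)"
proof
  fix i
  have "(\<lambda>k _. mat_times_col B x k) = mat_mult B (\<lambda>k _. x k)"
    by (intro ext) (rule mat_times_col_eq_mult)
  then show "mat_times_col (mat_mult A B) x i = mat_times_col A (mat_times_col B x) i"
    using mat_mult_assoc[OF assms, of "\<lambda>k _. x k"]
    by (simp only: mat_times_col_eq_mult[of _ _ i 0])
qed

lemma row_times_id: "row_times_mat x id_mat = x"
  using row_times_mat_eq_mult[of x id_mat 0] by (simp add: mat_mult_id_right)

lemma id_times_col: "mat_times_col id_mat x = x"
  by (rule ext) (simp add: mat_times_col_eq_mult[of _ _ _ 0] mat_mult_id_left)

section \<open>Shifted blocks\<close>

lemma sum_lessThan_add: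
  fixes f :: "nat \<Rightarrow> 'a::comm_monoid_add"
  shows "(\<Sum>k<n + m. f k) = (\<Sum>k<n. f k) + (\<Sum>k<m. f (n + k))"
  by (induction m) (simp_all add: add.assoc)

lemma bounded_shift_block: "bounded_mat N X \<Longrightarrow> bounded_mat (n + N) (shift_block n X)"
  by (auto simp: bounded_mat_def shift_block_def id_mat_def)

lemma finitary_shift_block: "finitary X \<Longrightarrow> finitary (shift_block n X)"
  using bounded_shift_block finitary_iff_bounded by blast

lemma shift_block_id_mat: "shift_block n id_mat = id_mat"
  by (auto simp: shift_block_def id_mat_def fun_eq_iff)

lemma shift_block_inject: "shift_block n X = shift_block n Y \<longleftrightarrow> X = Y"
proof
  assume *: "shift_block n X = shift_block n Y"
  have "X i j = Y i j" for i j
    using fun_cong[OF fun_cong[OF *, of "n + i"], of "n + j"] by (simp add: shift_block_def)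
  then show "X = Y" by blast
qed simp

lemma shift_block_mult_row:
  assumes "bounded_mat N X" "N \<le> M" "r < M"
  shows "mat_mult (shift_block n X) B (n + r) c = (\<Sum>l<M. X r l * B (n + l) c)"
proof -
  have "mat_mult (shift_block n X) B (n + r) c = (\<Sum>k<n + M. shift_block n X (n + r) k * B k c)"
    using bounded_shift_block[OF assms(1)] by (rule mat_mult_eq_sum) (use assms in auto)
  also have "\<dots> = (\<Sum>l<M. X r l * B (n + l) c)"
    unfolding sum_lessThan_add by (simp add: shift_block_def id_mat_def)
  finally show ?thesis .
qed

lemma shift_block_mult_low: "r < n \<Longrightarrow> mat_mult (shift_block n X) B r c = B r c"
  by (rule mat_mult_id_row) (simp add: shift_block_def)

lemma shift_block_mult:
  assumes "finitary X"
  shows "mat_mult (shift_block n X) (shift_block n Y) = shift_block n (mat_mult X Y)"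
proof (intro ext)
  fix i j
  obtain N where N: "bounded_mat N X" using assms finitary_iff_bounded by blast
  consider "i < n" | "j < n" | i' j' where "i = n + i'" "j = n + j'"
    by (metis le_Suc_ex not_less)
  then show "mat_mult (shift_block n X) (shift_block n Y) i j = shift_block n (mat_mult X Y) i j"
  proof cases
    case 1
    then show ?thesis unfolding shift_block_mult_low[OF 1] by (simp add: shift_block_def)
  next
    case 2
    then have "mat_mult (shift_block n X) (shift_block n Y) i j = shift_block n X i j"
      by (intro mat_mult_id_col) (simp add: shift_block_def)
    with 2 show ?thesis by (simp add: shift_block_def)
  next
    case 3
    have "N \<le> N + i' + 1" "i' < N + i' + 1" by auto
    note M = shift_block_mult_row[OF N this, of n "shift_block n Y" j] mat_mult_eq_sum[OF N this, of Y j']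
    show ?thesis using M 3 by (simp add: shift_block_def)
  qed
qed

lemma v_vec_add: "v_vec (n + j) = tvar ^ n * v_vec j"
  by (simp add: v_vec_def power_add)

lemma v_times_shift_block:
  assumes "finitary X"
  shows "row_times_mat v_vec (shift_block n X) (n + j) = tvar ^ n * row_times_mat v_vec X j"
proof -
  obtain N where N: "bounded_mat N X" using assms finitary_iff_bounded by blast
  have "row_times_mat v_vec (shift_block n X) (n + j)
      = (\<Sum>i<n + (N + j + 1). v_vec i * shift_block n X i (n + j))"
    by (rule row_times_mat_eq_sum[OF bounded_shift_block[OF N]]) auto
  also have "\<dots> = (\<Sum>i<N + j + 1. tvar ^ n * (v_vec i * X i j))"
    unfolding sum_lessThan_add by (simp add: shift_block_def id_mat_def v_vec_def power_add mult.assoc)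
  also have "\<dots> = tvar ^ n * row_times_mat v_vec X j"
    by (subst row_times_mat_eq_sum[OF N, of "N + j + 1"]) (auto simp: sum_distrib_left distrib_left)
  finally show ?thesis .
qed

text \<open>The tail of \<open>v_vec\<close> from position \<open>n\<close> is
  \<open>tvar ^ n\<close> times \<open>v_vec\<close>, and this factor is a unit, so it
  cancels.\<close>

lemma v_fixed_shift_block:
  assumes "finitary X"
  shows "row_times_mat v_vec (shift_block n X) = v_vec \<longleftrightarrow> row_times_mat v_vec X = v_vec"
proof
  assume *: "row_times_mat v_vec (shift_block n X) = v_vec"
  have cancel: "tvar_inv ^ n * (tvar ^ n * z) = z" for z
    by (simp add: tvar_tvar_inv flip: mult.assoc power_mult_distrib)
  show "row_times_mat v_vec X = v_vec"
  proof
    fix j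
    have "tvar ^ n * row_times_mat v_vec X j = tvar ^ n * v_vec j"
      using v_times_shift_block[OF assms, of n j] by (simp only: * v_vec_add)
    then show "row_times_mat v_vec X j = v_vec j" by (metis cancel)
  qed
next
  assume *: "row_times_mat v_vec X = v_vec"
  show "row_times_mat v_vec (shift_block n X) = v_vec"
  proof
    fix j
    show "row_times_mat v_vec (shift_block n X) j = v_vec j"
    proof (cases "j < n")
      case True
      then show ?thesis
        unfolding row_times_mat_eq_mult[of _ _ 0]
        by (intro mat_mult_id_col) (simp add: shift_block_def)
    next
      case False
      then obtain j' where "j = n + j'" by (metis le_Suc_ex not_less)
      then show ?thesis
        using v_times_shift_block[OF assms, of n j'] by (simp only: * v_vec_add)
    qed
  qed
qed

lemma u_fixed_shift_block:
  assumes "finitary X"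
  shows "mat_times_col (shift_block n X) u_vec = u_vec \<longleftrightarrow> mat_times_col X u_vec = u_vec"
proof -
  obtain N where N: "bounded_mat N X" using assms finitary_iff_bounded by blast
  have high: "mat_times_col (shift_block n X) u_vec (n + i) = mat_times_col X u_vec i" for i
  proof -
    have "N \<le> N + i + 1" "i < N + i + 1" by auto
    note shift_block_mult_row[OF N this, of n "\<lambda>k _. u_vec k" 0]
      mat_mult_eq_sum[OF N this, of "\<lambda>k _. u_vec k" 0]
    then show ?thesis by (simp add: mat_times_col_eq_mult[of _ _ _ 0] u_vec_def)
  qed
  have low: "mat_times_col (shift_block n X) u_vec i = u_vec i" if "i < n" for i
    using shift_block_mult_low[OF that] by (simp add: mat_times_col_eq_mult[of _ _ _ 0])
  show ?thesis
  proof
    assume "mat_times_col (shift_block n X) u_vec = u_vec"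
    then show "mat_times_col X u_vec = u_vec"
      using high by (metis ext u_vec_def)
  next
    assume "mat_times_col X u_vec = u_vec"
    then show "mat_times_col (shift_block n X) u_vec = u_vec"
      using low high by (intro ext) (metis le_Suc_ex not_less u_vec_def)
  qed
qed

text \<open>Conversely, comparing the first \<open>n\<close> rows and columns of the two inverse
  equations forces any inverse \<open>B\<close> into block form; its lower right corner then inverts
  \<open>X\<close>.\<close>

lemma shift_block_GL_iff: "shift_block n X \<in> carrier GL_inf \<longleftrightarrow> X \<in> carrier GL_inf"
proof
  assume "X \<in> carrier GL_inf"
  then obtain Y where "finitary X" "finitary Y" "mat_mult X Y = id_mat" "mat_mult Y X = id_mat"
    unfolding GL_inf_carrier by blast
  then have "mat_mult (shift_block n X) (shift_block n Y) = id_mat"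
    "mat_mult (shift_block n Y) (shift_block n X) = id_mat"
    by (simp_all add: shift_block_mult shift_block_id_mat)
  then show "shift_block n X \<in> carrier GL_inf"
    unfolding GL_inf_carrier using finitary_shift_block \<open>finitary X\<close> \<open>finitary Y\<close> by blast
next
  have unshift: "finitary (\<lambda>i j. A (n + i) (n + j))" if A: "finitary A" for A :: inf_mat
  proof -
    obtain N where "bounded_mat N A" using A unfolding finitary_iff_bounded by blast
    then have "bounded_mat N (\<lambda>i j. A (n + i) (n + j))"
      by (auto simp: bounded_mat_def id_mat_def)
    then show ?thesis unfolding finitary_iff_bounded by blast
  qed
  assume "shift_block n X \<in> carrier GL_inf"
  then obtain B where B: "finitary (shift_block n X)" "finitary B"
    "mat_mult (shift_block n X) B = id_mat" "mat_mult B (shift_block n X) = id_mat"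
    unfolding GL_inf_carrier by blast
  have X: "finitary X" using unshift[OF B(1)] by (simp add: shift_block_def)
  define Y where "Y = (\<lambda>i j. B (n + i) (n + j))"
  have Y: "finitary Y" using unshift[OF B(2)] by (simp add: Y_def)
  have "B i j = id_mat i j" if "i < n" for i j
    using shift_block_mult_low[OF that, of X B j] B(3) by simp
  moreover have "B i j = id_mat i j" if "j < n" for i j
    using mat_mult_id_col[of "shift_block n X" j B i] B(4) that by (simp add: shift_block_def)
  ultimately have "B = shift_block n Y"
    by (auto simp: shift_block_def Y_def fun_eq_iff)
  then have "shift_block n (mat_mult X Y) = shift_block n id_mat"
    "shift_block n (mat_mult Y X) = shift_block n id_mat"
    using B(3,4) by (simp_all add: shift_block_id_mat flip: shift_block_mult[OF X] shift_block_mult[OF Y])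
  then show "X \<in> carrier GL_inf"
    unfolding GL_inf_carrier shift_block_inject using X Y by blast
qed

section \<open>The subgroups \<open>G_sub\<close>\<close>

lemma GL_finitary: "A \<in> carrier GL_inf \<Longrightarrow> finitary A"
  by (simp add: GL_inf_carrier)

text \<open>Trades the hidden block \<open>X\<close> for conditions on \<open>A\<close> itself, so
  that the group laws and monotonicity can be checked entrywise.\<close>

lemma G_sub_iff:
  "A \<in> G_sub n \<longleftrightarrow> A \<in> carrier GL_inf \<and> (\<forall>i j. i < n \<or> j < n \<longrightarrow> A i j = id_mat i j)
     \<and> row_times_mat v_vec A = v_vec \<and> mat_times_col A u_vec = u_vec"
  (is "_ \<longleftrightarrow> ?R")
proof
  assume "A \<in> G_sub n"
  then obtain X where X: "A = shift_block n X" "X \<in> carrier GL_inf"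
    "row_times_mat v_vec X = v_vec" "mat_times_col X u_vec = u_vec"
    unfolding G_sub_def by blast
  have "A i j = id_mat i j" if "i < n \<or> j < n" for i j
    using that by (simp add: X(1) shift_block_def)
  with X show ?R
    using GL_finitary[OF X(2)]
    by (simp add: shift_block_GL_iff v_fixed_shift_block u_fixed_shift_block)
next
  assume R: ?R
  define X where "X = (\<lambda>i j. A (n + i) (n + j))"
  have A: "A = shift_block n X"
    using R by (auto simp: shift_block_def X_def fun_eq_iff)
  then have "X \<in> carrier GL_inf" using R shift_block_GL_iff by simp
  then show "A \<in> G_sub n"
    unfolding G_sub_def
    using R A v_fixed_shift_block[OF GL_finitary] u_fixed_shift_block[OF GL_finitary] by auto
qed

interpretation GL: group GL_inf by (rule group_GL_inf)

lemma subgroup_G_sub: "subgroup (G_sub n) GL_inf"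
proof (rule GL.subgroupI)
  show "G_sub n \<subseteq> carrier GL_inf" by (auto simp: G_sub_iff)
  have "id_mat \<in> G_sub n"
    using GL.one_closed by (simp add: G_sub_iff row_times_id id_times_col)
  then show "G_sub n \<noteq> {}" by blast
next
  fix A assume A: "A \<in> G_sub n"
  define B where "B = inv\<^bsub>GL_inf\<^esub> A"
  have cl: "A \<in> carrier GL_inf" "B \<in> carrier GL_inf" using A by (auto simp: G_sub_iff B_def)
  have AB: "mat_mult A B = id_mat" "mat_mult B A = id_mat"
    using GL.r_inv[OF cl(1)] GL.l_inv[OF cl(1)] by (simp_all add: B_def)
  have "B i j = id_mat i j" if "i < n" for i j
    using mat_mult_id_row[of A i B j] A that AB by (simp add: G_sub_iff)
  moreover have "B i j = id_mat i j" if "j < n" for i j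
    using mat_mult_id_col[of A j B i] A that AB by (simp add: G_sub_iff)
  \<comment> \<open>Apply the fixed row to \<open>A B = 1\<close>: since \<open>A\<close> fixes it,
    so does \<open>B\<close>. For the column, \<open>B A = 1\<close> is used.\<close>
  moreover have "row_times_mat v_vec B = v_vec"
    using row_times_mat_mult[of A B v_vec] A GL_finitary cl by (simp add: AB G_sub_iff row_times_id)
  moreover have "mat_times_col B u_vec = u_vec"
    using mat_times_col_mult[of B A u_vec] A GL_finitary cl by (simp add: AB G_sub_iff id_times_col)
  ultimately show "B \<in> G_sub n" using cl by (auto simp: G_sub_iff)
next
  fix A B assume AB: "A \<in> G_sub n" "B \<in> G_sub n"
  then have cl: "A \<in> carrier GL_inf" "B \<in> carrier GL_inf" by (auto simp: G_sub_iff)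
  have "mat_mult A B i j = id_mat i j" if "i < n" for i j
    using mat_mult_id_row[of A i B j] AB that by (simp add: G_sub_iff)
  moreover have "mat_mult A B i j = id_mat i j" if "j < n" for i j
    using mat_mult_id_col[of B j A i] AB that by (simp add: G_sub_iff)
  moreover have "mat_mult A B \<in> carrier GL_inf" using GL.m_closed[OF cl] by simp
  ultimately show "A \<otimes>\<^bsub>GL_inf\<^esub> B \<in> G_sub n"
    using AB GL_finitary[OF cl(1)] GL_finitary[OF cl(2)]
    by (auto simp: G_sub_iff row_times_mat_mult mat_times_col_mult)
qed

lemma G_sub_antimono: "m \<le> n \<Longrightarrow> G_sub n \<subseteq> G_sub m"
  by (auto simp: G_sub_iff)

text \<open>\<open>A\<close> acts on the coordinates below \<open>n\<close> and \<open>x\<close> on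
  the others, so both products are the block sum of the two; the mixed entries vanish.\<close>

lemma bounded_commutes_G_sub:
  assumes A: "bounded_mat n A" and x: "x \<in> G_sub n"
  shows "mat_mult x A = mat_mult A x"
proof (intro ext)
  fix i j
  have x': "x i j = id_mat i j" if "i < n \<or> j < n" for i j using x that by (auto simp: G_sub_iff)
  have A': "A i j = id_mat i j" if "n \<le> i \<or> n \<le> j" for i j using A that by (auto simp: bounded_mat_def)
  have off: "x i k = 0 \<or> A k j = 0" if "i < n \<longleftrightarrow> \<not> j < n" for i j k
    using that x'[of i k] A'[of k j] by (cases "k < n") (auto simp: id_mat_def)
  have off': "A i k = 0 \<or> x k j = 0" if "i < n \<longleftrightarrow> \<not> j < n" for i j k
    using that x'[of k j] A'[of i k] by (cases "k < n") (auto simp: id_mat_def)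
  consider "i < n" "j < n" | "\<not> i < n" "\<not> j < n" | "i < n \<longleftrightarrow> \<not> j < n" by blast
  then show "mat_mult x A i j = mat_mult A x i j"
  proof cases
    case 1
    then show ?thesis using mat_mult_id_row[of x i A j] mat_mult_id_col[of x j A i] x' by simp
  next
    case 2
    then show ?thesis using mat_mult_id_row[of A i x j] mat_mult_id_col[of A j x i] A' by simp
  next
    case 3
    then show ?thesis using mat_mult_eq_0[of x i A j] mat_mult_eq_0[of A i x j] off off' by simp
  qed
qed

text \<open>The 2 by 2 block fixes the row \<open>(1, t)\<close> and the column
  \<open>(1, 1)\<close>: its columns give \<open>(1 - t) + t = 1\<close> and
  \<open>1 * t = t\<close>, and its rows sum to 1.\<close>

lemma burau_gen_in_G_sub:
  assumes "n \<le> i"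
  shows "burau_gen i \<in> G_sub n"
proof -
  have "row_times_mat v_vec (burau_gen i) j = v_vec j" for j
  proof -
    consider "j = i" | "j = i + 1" | "j \<noteq> i" "j \<noteq> i + 1" by blast
    then show ?thesis
    proof cases
      case 1
      have "row_times_mat v_vec (burau_gen i) j = (\<Sum>k<i + 2. v_vec k * burau_gen i k j)"
        using 1 by (intro row_times_mat_eq_sum[OF bounded_burau_gen(1)]) auto
      also have "\<dots> = (\<Sum>k<i + 2. (if k = i then 1 - tvar else if k = i + 1 then 1 else 0) * v_vec k)"
        using 1 by (intro sum.cong) (auto simp: burau_gen_def id_mat_def)
      also have "\<dots> = v_vec j"
        using two_term_sum[of i "i + 2" "1 - tvar" 1 v_vec] 1 by (simp add: v_vec_def algebra_simps)
      finally show ?thesis .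
    next
      case 2
      have "row_times_mat v_vec (burau_gen i) j = (\<Sum>k<i + 2. v_vec k * burau_gen i k j)"
        using 2 by (intro row_times_mat_eq_sum[OF bounded_burau_gen(1)]) auto
      also have "\<dots> = (\<Sum>k<i + 2. (if k = i then tvar else if k = i + 1 then 0 else 0) * v_vec k)"
        using 2 by (intro sum.cong) (auto simp: burau_gen_def id_mat_def)
      also have "\<dots> = v_vec j"
        using two_term_sum[of i "i + 2" tvar 0 v_vec] 2 by (simp add: v_vec_def)
      finally show ?thesis .
    next
      case 3
      then show ?thesis
        unfolding row_times_mat_eq_mult[of _ _ 0]
        by (intro mat_mult_id_col) (auto simp: burau_gen_def id_mat_def)
    qed
  qed
  moreover have "mat_times_col (burau_gen i) u_vec = u_vec"
    by (intro ext) (simp add: mat_times_col_eq_mult[of _ _ _ 0] burau_gen_mult u_vec_def)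
  moreover have "burau_gen i r c = id_mat r c" if "r < n \<or> c < n" for r c
    using that assms by (auto simp: burau_gen_def id_mat_def)
  ultimately show ?thesis using burau_gen_closed by (auto simp: G_sub_iff)
qed

section \<open>Burau images of block swaps\<close>

interpretation burau: group_hom B_inf GL_inf burau
  using burau_hom by unfold_locales

lemma burau_in_G_sub: "x \<in> B_sub n \<Longrightarrow> burau x \<in> G_sub n"
proof (induction rule: B_sub_induct)
  case one
  show ?case using subgroup.one_closed[OF subgroup_G_sub] by simp
next
  case (gen j)
  then show ?case by (simp add: burau_sigma burau_gen_in_G_sub)
next
  case (inv x)
  then show ?case using subgroup.m_inv_closed[OF subgroup_G_sub] by simp
next
  case (mult x y)
  then show ?case using subgroup.m_closed[OF subgroup_G_sub, of "burau x" n "burau y"] by simp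
qed

lemma burau_finitary: "finitary (burau x)"
  using GL_finitary burau.hom_closed by simp

lemma burau_mult: "burau (x \<otimes>\<^bsub>B_inf\<^esub> y) = mat_mult (burau x) (burau y)"
  by simp

text \<open>Describing the action on an arbitrary \<open>A\<close> instead of the entries keeps the
  induction simple: the last generator acts on \<open>A\<close> first, and the hypothesis is used
  for the result.\<close>

lemma burau_swap_row_mult:
  "mat_mult (burau (braid_swap b 1 n)) A r c =
    (if r = b then (1 - tvar) * (\<Sum>i<n. tvar ^ i * A (b + i) c) + tvar ^ n * A (b + n) c
     else if b < r \<and> r \<le> b + n then A (r - 1) c else A r c)"
proof (induction n arbitrary: A)
  case 0
  show ?case using mat_mult_id_left[of A] burau.hom_one by simp
next
  case (Suc n)
  have "burau (braid_swap b 1 (Suc n)) = mat_mult (burau (braid_swap b 1 n)) (burau_gen (b + n))"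
    using braid_swap_m_1[of "b + n" 1] braid_swap_1_1[of "b + n"]
    by (simp add: braid_swap_Suc burau_sigma)
  then have "mat_mult (burau (braid_swap b 1 (Suc n))) A r c
      = mat_mult (burau (braid_swap b 1 n)) (mat_mult (burau_gen (b + n)) A) r c"
    using mat_mult_assoc[OF burau_finitary GL_finitary[OF burau_gen_closed]] by simp
  then show ?case
    unfolding Suc.IH by (auto simp: burau_gen_mult algebra_simps)
qed

text \<open>A new row reads rows \<open>b + m + i\<close> of the previous result, and for
  \<open>i < n\<close> these are the rows \<open>b + i\<close> of \<open>A\<close>. Hence every row
  contributes the same sum, which is why the rows of the upper left block of \<open>Theta\<close>
  coincide.\<close>

lemma burau_swap_mult:
  "mat_mult (burau (braid_swap b m n)) A r c =
    (if b \<le> r \<and> r < b + m then (1 - tvar) * (\<Sum>i<n. tvar ^ i * A (b + i) c) + tvar ^ n * A (r + n) c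
     else if b + m \<le> r \<and> r < b + m + n then A (r - m) c else A r c)"
proof (induction m arbitrary: r)
  case 0
  have "braid_swap b 0 n = \<one>\<^bsub>B_inf\<^esub>" by (induction n) (simp_all add: braid_swap_Suc)
  then show ?case using mat_mult_id_left[of A] burau.hom_one by auto
next
  case (Suc m)
  have "mat_mult (burau (braid_swap b (Suc m) n)) A r c
     = mat_mult (burau (braid_swap (b + m) 1 n)) (mat_mult (burau (braid_swap b m n)) A) r c"
    using braid_swap_add_left[of b m 1 n] mat_mult_assoc[OF burau_finitary burau_finitary]
    by (simp add: burau_mult)
  then show ?case
    unfolding burau_swap_row_mult Suc.IH by (auto simp: ac_simps)
qed

lemma sum_id_mat:
  "(\<Sum>i<n. f i * id_mat (b + i) c) = (if b \<le> c \<and> c < b + n then f (c - b) else (0::laurent))"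
proof -
  have "(\<Sum>i<n. f i * id_mat (b + i) c) = (\<Sum>i<n. if i = c - b then (if b \<le> c then f i else 0) else 0)"
    by (intro sum.cong) (auto simp: id_mat_def)
  then show ?thesis by auto
qed

lemma burau_swap_entry:
  "burau (braid_swap b m n) r c =
    (if b \<le> r \<and> r < b + m then (1 - tvar) * (if b \<le> c \<and> c < b + n then tvar ^ (c - b) else 0)
        + tvar ^ n * id_mat (r + n) c
     else if b + m \<le> r \<and> r < b + m + n then id_mat (r - m) c else id_mat r c)"
  using burau_swap_mult[of b m n id_mat r c] by (simp add: mat_mult_id_right sum_id_mat)

lemma burau_swap_eq_Theta: "burau (braid_swap b n n) = Theta b n"
proof (intro ext)
  fix r c
  consider "r < b" | "b \<le> r" "r < b + n" | "b + n \<le> r" "r < b + n + n" | "b + n + n \<le> r"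
    by linarith
  then show "burau (braid_swap b n n) r c = Theta b n r c"
    unfolding burau_swap_entry Theta_def
    by cases (auto simp: id_mat_def)
qed

lemma bounded_burau_swap: "bounded_mat (b + m + n) (burau (braid_swap b m n))"
  by (auto simp: bounded_mat_def burau_swap_entry id_mat_def)

text \<open>A single \<open>X\<close> serves all levels: the element that emerges from
  \<open>Theta\<close> is the same block, placed at \<open>b + n\<close>.\<close>

lemma G_sub_boundedE:
  assumes "g \<in> G_sub b"
  obtains X N where "\<forall>n. shift_block n X \<in> G_sub n" "g = shift_block b X" "bounded_mat N X"
    "row_times_mat v_vec X = v_vec" "mat_times_col X u_vec = u_vec"
  using assms GL_finitary finitary_iff_bounded unfolding G_sub_def by blast

section \<open>Moving elements of \<open>G_sub\<close> through \<open>Theta\<close>\<close>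

lemma Theta_mult:
  "mat_mult (Theta b n) A r c =
    (if b \<le> r \<and> r < b + n then (1 - tvar) * (\<Sum>i<n. tvar ^ i * A (b + i) c) + tvar ^ n * A (r + n) c
     else if b + n \<le> r \<and> r < b + n + n then A (r - n) c else A r c)"
  unfolding burau_swap_eq_Theta[symmetric] by (rule burau_swap_mult)

lemma shift_block_row_id:
  "bounded_mat N X \<Longrightarrow> b + N \<le> r \<Longrightarrow> shift_block b X r c = id_mat r c"
  using bounded_shift_block[of N X b] by (simp add: bounded_mat_def)

text \<open>All rows of the upper left block of \<open>Theta\<close> agree, so multiplying it on the
  left by \<open>X\<close> multiplies them by the row sums of \<open>X\<close>, which are 1 because
  \<open>X\<close> fixes \<open>u_vec\<close>. The adjacent scalar block becomes
  \<open>tvar ^ n\<close> times \<open>X\<close>, the effect of the shifted \<open>X\<close> on the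
  right.\<close>

lemma shift_block_Theta:
  assumes N: "bounded_mat N X" "N \<le> n" and u: "mat_times_col X u_vec = u_vec"
  shows "mat_mult (shift_block b X) (Theta b n) = mat_mult (Theta b n) (shift_block (b + n) X)"
proof (intro ext)
  fix r c
  consider "r < b" | "b + n \<le> r" | r' where "r = b + r'" "r' < n"
    by (metis le_Suc_ex not_less nat_add_left_cancel_less)
  then show "mat_mult (shift_block b X) (Theta b n) r c = mat_mult (Theta b n) (shift_block (b + n) X) r c"
  proof cases
    case 1
    then show ?thesis
      unfolding shift_block_mult_low[OF 1] Theta_mult by (simp add: Theta_def shift_block_def)
  next
    case 2
    have "mat_mult (shift_block b X) (Theta b n) r c = Theta b n r c"
      using shift_block_row_id[OF N(1)] 2 N(2) by (intro mat_mult_id_row) simp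
    also have "\<dots> = mat_mult (Theta b n) (shift_block (b + n) X) r c"
    proof (cases "r < b + n + n")
      case True
      then have "shift_block (b + n) X (r - n) c = id_mat (r - n) c"
        using 2 by (auto simp: shift_block_def)
      then show ?thesis using 2 True unfolding Theta_mult by (auto simp: Theta_def id_mat_def)
    next
      case False
      then show ?thesis
        using shift_block_row_id[OF N(1), of "b + n" r c] N(2) unfolding Theta_mult
        by (simp add: Theta_def)
    qed
    finally show ?thesis .
  next
    case (3 r')
    have rowsum: "(\<Sum>l<n. X r' l) = 1"
      using mat_mult_eq_sum[OF N 3(2), of "\<lambda>k _. u_vec k" 0] fun_cong[OF u, of r']
      by (simp add: mat_times_col_eq_mult[of _ _ _ 0] u_vec_def)
    have L: "mat_mult (shift_block b X) (Theta b n) r c = (\<Sum>l<n. X r' l * Theta b n (b + l) c)"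
      unfolding 3(1) by (rule shift_block_mult_row[OF N 3(2)])
    have "(\<Sum>i<n. tvar ^ i * shift_block (b + n) X (b + i) c) = (\<Sum>i<n. tvar ^ i * id_mat (b + i) c)"
      by (intro sum.cong) (auto simp: shift_block_def)
    then have R: "mat_mult (Theta b n) (shift_block (b + n) X) r c =
       (1 - tvar) * (if b \<le> c \<and> c < b + n then tvar ^ (c - b) else 0) + tvar ^ n * shift_block (b + n) X (r + n) c"
      using 3 unfolding Theta_mult by (simp add: sum_id_mat)
    consider "c < b" | "b \<le> c" "c < b + n" | c' where "c = b + n + c'"
      by (metis le_Suc_ex not_less)
    then show ?thesis
    proof cases
      case 1
      then show ?thesis unfolding L R using 3 by (simp add: Theta_def shift_block_def id_mat_def)
    next
      case 2
      then have "(\<Sum>l<n. X r' l * Theta b n (b + l) c) = (\<Sum>l<n. X r' l * ((1 - tvar) * tvar ^ (c - b)))"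
        by (intro sum.cong) (auto simp: Theta_def)
      also have "\<dots> = (1 - tvar) * tvar ^ (c - b)"
        by (simp add: rowsum flip: sum_distrib_right)
      finally show ?thesis unfolding L R using 2 3 by (simp add: shift_block_def id_mat_def)
    next
      case (3 c')
      have "(\<Sum>l<n. X r' l * Theta b n (b + l) c) = (\<Sum>l<n. if l = c' then X r' l * tvar ^ n else 0)"
        using 3 by (intro sum.cong) (auto simp: Theta_def)
      also have "\<dots> = (if c' < n then X r' c' * tvar ^ n else 0)" by simp
      also have "\<dots> = tvar ^ n * X r' c'"
        using N \<open>r' < n\<close> by (auto simp: bounded_mat_def id_mat_def)
      finally show ?thesis unfolding L R using 3 \<open>r = _\<close> by (simp add: shift_block_def)
    qed
  qed
qed

text \<open>Dual to \<open>shift_block_Theta\<close>: each row of the upper left block is a multiple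
  of an initial piece of \<open>v_vec\<close>, which \<open>X\<close> fixes from the right, and the
  identity block below it becomes \<open>X\<close>.\<close>

lemma Theta_shift_block:
  assumes N: "bounded_mat N X" "N \<le> n" and v: "row_times_mat v_vec X = v_vec"
  shows "mat_mult (Theta b n) (shift_block b X) = mat_mult (shift_block (b + n) X) (Theta b n)"
proof (intro ext)
  fix r c
  \<comment> \<open>Since \<open>n\<close> bounds \<open>X\<close>, the first \<open>n\<close> terms
    are the whole sum for columns below \<open>n\<close>, and all of them vanish for later
    columns.\<close>
  have colsum: "(\<Sum>i<n. tvar ^ i * X i c') = (if c' < n then tvar ^ c' else 0)" for c'
  proof (cases "c' < n")
    case True
    then show ?thesis
      using row_times_mat_eq_sum[OF N True, of v_vec] v by (simp add: v_vec_def)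
  next
    case False
    then show ?thesis using N by (auto simp: bounded_mat_def id_mat_def intro!: sum.neutral)
  qed
  consider "r < b" | "b \<le> r" "r < b + n" | r' where "r = b + n + r'" "r' < n" | "b + n + n \<le> r"
    by (metis le_Suc_ex not_less nat_add_left_cancel_less)
  then show "mat_mult (Theta b n) (shift_block b X) r c = mat_mult (shift_block (b + n) X) (Theta b n) r c"
  proof cases
    case 1
    then have "r < b + n" by simp
    with 1 show ?thesis
      unfolding shift_block_mult_low[OF \<open>r < b + n\<close>] Theta_mult by (simp add: Theta_def shift_block_def)
  next
    case 2
    have id: "shift_block b X (r + n) c = id_mat (r + n) c"
      using shift_block_row_id[OF N(1)] 2 N(2) by simp
    have "(\<Sum>i<n. tvar ^ i * shift_block b X (b + i) c) = (if b \<le> c \<and> c < b + n then tvar ^ (c - b) else 0)"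
    proof (cases "c < b")
      case True
      then show ?thesis by (auto simp: shift_block_def id_mat_def intro!: sum.neutral)
    next
      case False
      then show ?thesis using colsum[of "c - b"] by (auto simp: shift_block_def)
    qed
    then show ?thesis
      unfolding shift_block_mult_low[OF 2(2)] Theta_mult id using 2
      by (auto simp: Theta_def id_mat_def)
  next
    case (3 r')
    have "mat_mult (shift_block (b + n) X) (Theta b n) r c
        = (\<Sum>l<n. X r' l * Theta b n (b + n + l) c)"
      unfolding 3(1) by (rule shift_block_mult_row[OF N 3(2)])
    also have "\<dots> = (\<Sum>l<n. X r' l * id_mat (b + l) c)"
      by (intro sum.cong) (auto simp: Theta_def id_mat_def)
    also have "\<dots> = (if b \<le> c \<and> c < b + n then X r' (c - b) else 0)" by (rule sum_id_mat)
    also have "\<dots> = shift_block b X (b + r') c"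
      using N 3(2) by (auto simp: shift_block_def bounded_mat_def id_mat_def)
    also have "\<dots> = mat_mult (Theta b n) (shift_block b X) r c"
      unfolding Theta_mult using 3 by simp
    finally show ?thesis by simp
  next
    case 4
    have "mat_mult (shift_block (b + n) X) (Theta b n) r c = Theta b n r c"
      using shift_block_row_id[OF N(1)] 4 N(2) by (intro mat_mult_id_row) simp
    also have "\<dots> = mat_mult (Theta b n) (shift_block b X) r c"
      using 4 shift_block_row_id[OF N(1), of b r c] N(2) unfolding Theta_mult
      by (auto simp: Theta_def)
    finally show ?thesis by simp
  qed
qed

section \<open>The two systems and the functor between them\<close>

interpretation braid_system: block_swap_system B_inf B_sub braid_swap
proof (intro block_swap_system.intro block_swap_system_axioms.intro)
  fix p show "\<exists>N. \<forall>x\<in>B_sub N. x \<otimes>\<^bsub>B_inf\<^esub> p = p \<otimes>\<^bsub>B_inf\<^esub> x"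
    using braid_commute_ex by (simp add: commutes_def)
next
  fix x b m n assume "x \<in> B_sub (b + m + n)"
  then show "x \<otimes>\<^bsub>B_inf\<^esub> braid_swap b m n = braid_swap b m n \<otimes>\<^bsub>B_inf\<^esub> x"
    using braid_swap_commutes by (simp add: commutes_def)
qed (simp_all add: group_B_inf subgroup_B_sub B_sub_antimono braid_swap_in braid_swap_add_left
      braid_swap_add_right braid_pass_right braid_pass_left)

text \<open>Additivity and membership are carried over by \<open>burau\<close>. Commutation and
  passing are proved for matrices, since elements of \<open>G_sub\<close> are not given as Burau
  images.\<close>

interpretation GL_system: block_swap_system GL_inf G_sub "\<lambda>b m n. burau (braid_swap b m n)"
proof (intro block_swap_system.intro block_swap_system_axioms.intro)
  fix p assume "p \<in> carrier GL_inf"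
  then obtain N where "bounded_mat N p" using GL_finitary finitary_iff_bounded by blast
  then show "\<exists>N. \<forall>x\<in>G_sub N. x \<otimes>\<^bsub>GL_inf\<^esub> p = p \<otimes>\<^bsub>GL_inf\<^esub> x"
    using bounded_commutes_G_sub by auto
next
  fix x b m n assume "x \<in> G_sub (b + m + n)"
  then show "x \<otimes>\<^bsub>GL_inf\<^esub> burau (braid_swap b m n) = burau (braid_swap b m n) \<otimes>\<^bsub>GL_inf\<^esub> x"
    using bounded_commutes_G_sub[OF bounded_burau_swap] by simp
next
  fix b m1 m2 n
  show "burau (braid_swap b (m1 + m2) n)
      = burau (braid_swap (b + m1) m2 n) \<otimes>\<^bsub>GL_inf\<^esub> burau (braid_swap b m1 n)"
    by (simp add: braid_swap_add_left)
next
  fix b m n1 n2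
  show "burau (braid_swap b m (n1 + n2))
      = burau (braid_swap b m n1) \<otimes>\<^bsub>GL_inf\<^esub> burau (braid_swap (b + n1) m n2)"
    by (simp add: braid_swap_add_right)
next
  fix k b assume "k \<in> G_sub b"
  then obtain X N where X: "\<forall>n. shift_block n X \<in> G_sub n" "k = shift_block b X" "bounded_mat N X"
    "row_times_mat v_vec X = v_vec" "mat_times_col X u_vec = u_vec"
    by (rule G_sub_boundedE)
  show "\<forall>\<^sub>F n in sequentially. \<exists>k'\<in>G_sub (b + n).
      k \<otimes>\<^bsub>GL_inf\<^esub> burau (braid_swap b n n) = burau (braid_swap b n n) \<otimes>\<^bsub>GL_inf\<^esub> k'"
    using eventually_ge_at_top[of N]
  proof eventually_elim
    case (elim n)
    show ?case
      using shift_block_Theta[OF X(3) elim X(5), of b] X(1)[rule_format, of "b + n"]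
      by (auto simp: X(2) burau_swap_eq_Theta)
  qed
  show "\<forall>\<^sub>F n in sequentially. \<exists>k'\<in>G_sub (b + n).
      burau (braid_swap b n n) \<otimes>\<^bsub>GL_inf\<^esub> k = k' \<otimes>\<^bsub>GL_inf\<^esub> burau (braid_swap b n n)"
    using eventually_ge_at_top[of N]
  proof eventually_elim
    case (elim n)
    show ?case
      using Theta_shift_block[OF X(3) elim X(4), of b] X(1)[rule_format, of "b + n"]
      by (auto simp: X(2) burau_swap_eq_Theta)
  qed
qed (simp_all add: group_GL_inf subgroup_G_sub G_sub_antimono burau_in_G_sub braid_swap_in)

theorem proposition1p12:
  shows "\<exists>F :: nat \<Rightarrow> nat \<Rightarrow> braid set \<Rightarrow> inf_mat set.
     (\<forall>r s. \<forall>g\<in>carrier B_inf.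
        F r s (double_coset B_inf (B_sub s) g (B_sub r)) =
          double_coset GL_inf (G_sub s) (burau g) (G_sub r)) \<and>
     is_functor braid_cat GL_cat (\<lambda>r. r) F"
proof -
  \<comment> \<open>Both families are rewritten as diagonals of rectangular swaps, the form in which
    \<open>double_coset_functor\<close> is stated.\<close>
  have "theta = (\<lambda>b n. braid_swap b n n)" "Theta = (\<lambda>b n. burau (braid_swap b n n))"
    by (simp_all add: fun_eq_iff theta_eq_swap burau_swap_eq_Theta)
  moreover have "burau ` B_sub n \<subseteq> G_sub n" for n
    using burau_in_G_sub by blast
  ultimately show ?thesis
    unfolding braid_cat_def GL_cat_def
    using double_coset_functor[OF braid_system.block_swap_system_axioms
        GL_system.block_swap_system_axioms burau_hom]
    by simp
qed

end
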